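(* Let $m\ge0$, let $E=\{x_1,\dots,x_n\}\subset V_m$ be a set of distinct points containing three points, labelled $x_1,x_2,x_3$, for which the matrix $(h_j(x_i))_{1\le i\le3,\,0\le j\le2}$ is invertible, and let $a_1,\dots,a_n\in\mathbb{R}$. Let $u$ be the unique minimizer of $\int_{SG}|\Delta u|^2\,d\mu$ among all $u\in\operatorname{dom}_{L^2}\Delta$ with $u(x_i)=a_i$ for all $i$ (for this $u$, $\Delta u$ is continuous). Then for every $z\in V_m\setminus V_0$, $$\Delta_mu(z)=\frac{1}{45\cdot5^m}\Bigl(14\,\Delta u(z)+4\sum_{y\sim_mz}\Delta u(y)\Bigr).$$
   Context: Let $q_0,q_1,q_2$ be the vertices of an equilateral triangle in the plane, $F_i(x)=\frac12(x+q_i)$, and let $SG$ (the Sierpinski gasket) be the unique nonempty compact set with $SG=\bigcup_{i}F_i(SG)$. For a word $w$ of length $|w|=m$ let $F_w=F_{w_1}\circ\cdots\circ F_{w_m}$. Put $V_0=\{q_0,q_1,q_2\}$, $V_m=\bigcup_iF_iV_{m-1}$; $x\sim_m y$ means $x\ne y$ and $x,y\in F_wV_0$ for some word $w$ of length $m$. The energy of a continuous $u:SG\to\mathbb{R}$ is $\mathcal{E}(u)=\lim_{m\to\infty}\left(\frac53\right)^m\sum_{\{x,y\}:x\sim_m y}(u(x)-u(y))^2$, $\operatorname{dom}\mathcal{E}$ is the set of continuous $u$ with $\mathcal{E}(u)<\infty$, and $\mathcal{E}(u,v)$ is the associated bilinear form. $h_j$ is the harmonic function (least energy given its values on $V_0$)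 with $h_j(q_i)=\delta_{ij}$. $\mu$ is the self-similar probability measure with $\mu(F_wSG)=3^{-|w|}$. $\operatorname{dom}_{L^2}\Delta$ is the set of $u\in\operatorname{dom}\mathcal{E}$ for which there is $f\in L^2(\mu)$ with $\mathcal{E}(u,v)=-\int fv\,d\mu$ for all $v\in\operatorname{dom}\mathcal{E}$ with $v|_{V_0}=0$; then $\Delta u:=f$. The discrete Laplacian is $\Delta_mu(z)=\sum_{y\sim_mz}(u(y)-u(z))$ for $z\in V_m\setminus V_0$. *)

theory Defs
  imports "HOL-Probability.Probability"
begin

text \<open>
  The boundary points are a family \<open>q\<close> indexed by the three-element type \<open>3\<close>, whose elements
  are \<open>0\<close>, \<open>1\<close> and \<open>2\<close>. Functions on the gasket are total functions on the plane; only their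
  values on \<open>SG q\<close> are ever used.
\<close>

definition equilateral :: "(3 \<Rightarrow> real^2) \<Rightarrow> bool" where
  "equilateral q \<longleftrightarrow> (\<exists>d>0. \<forall>i j. i \<noteq> j \<longrightarrow> dist (q i) (q j) = d)"

definition F :: "(3 \<Rightarrow> real^2) \<Rightarrow> 3 \<Rightarrow> real^2 \<Rightarrow> real^2" where
  "F q i x = (1/2) *\<^sub>R (x + q i)"

primrec F_word :: "(3 \<Rightarrow> real^2) \<Rightarrow> 3 list \<Rightarrow> real^2 \<Rightarrow> real^2" where
  "F_word q [] = id"
| "F_word q (i # w) = F q i \<circ> F_word q w"

definition SG :: "(3 \<Rightarrow> real^2) \<Rightarrow> (real^2) set" where
  "SG q = (THE K. compact K \<and> K \<noteq> {} \<and> K = (\<Union>i. F q i ` K))"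

primrec V :: "(3 \<Rightarrow> real^2) \<Rightarrow> nat \<Rightarrow> (real^2) set" where
  "V q 0 = range q"
| "V q (Suc m) = (\<Union>i. F q i ` V q m)"

definition adjacent :: "(3 \<Rightarrow> real^2) \<Rightarrow> nat \<Rightarrow> real^2 \<Rightarrow> real^2 \<Rightarrow> bool" where
  "adjacent q m x y \<longleftrightarrow>
     x \<noteq> y \<and> (\<exists>w. length w = m \<and> x \<in> F_word q w ` V q 0 \<and> y \<in> F_word q w ` V q 0)"

text \<open>
  The sum below runs over ordered pairs, so every edge occurs twice; hence the division by 2.
\<close>

definition graph_energy :: "(3 \<Rightarrow> real^2) \<Rightarrow> nat \<Rightarrow> (real^2 \<Rightarrow> real) \<Rightarrow> real" where
  "graph_energy q m u =
     (5/3) ^ m * ((\<Sum>(x, y) \<in> {(x, y). adjacent q m x y}. (u x - u y)\<^sup>2) / 2)"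

text \<open>
  The graph energies increase with the level, so for continuous \<open>u\<close> the limit exists in
  \<open>[0, \<infinity>]\<close>.
\<close>

definition energy :: "(3 \<Rightarrow> real^2) \<Rightarrow> (real^2 \<Rightarrow> real) \<Rightarrow> ereal" where
  "energy q u = lim (\<lambda>m. ereal (graph_energy q m u))"

definition dom_energy :: "(3 \<Rightarrow> real^2) \<Rightarrow> (real^2 \<Rightarrow> real) set" where
  "dom_energy q = {u. continuous_on (SG q) u \<and> energy q u < \<infinity>}"

text \<open>The bilinear form associated with the energy, by polarization; meant for \<open>dom_energy\<close>.\<close>

definition energy_form ::
  "(3 \<Rightarrow> real^2) \<Rightarrow> (real^2 \<Rightarrow> real) \<Rightarrow> (real^2 \<Rightarrow> real) \<Rightarrow> real" where
  "energy_form q u v =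
     (real_of_ereal (energy q (\<lambda>x. u x + v x)) - real_of_ereal (energy q (\<lambda>x. u x - v x))) / 4"

definition harmonic :: "(3 \<Rightarrow> real^2) \<Rightarrow> (real^2 \<Rightarrow> real) \<Rightarrow> bool" where
  "harmonic q h \<longleftrightarrow> h \<in> dom_energy q \<and>
     (\<forall>v \<in> dom_energy q. (\<forall>x \<in> V q 0. v x = h x) \<longrightarrow> energy q h \<le> energy q v)"

text \<open>
  The conditions determine the function on \<open>SG q\<close>; the choice only concerns values off the gasket.
\<close>

definition harmonic_basis :: "(3 \<Rightarrow> real^2) \<Rightarrow> 3 \<Rightarrow> real^2 \<Rightarrow> real" where
  "harmonic_basis q j = (SOME h. harmonic q h \<and> (\<forall>i. h (q i) = (if i = j then 1 else 0)))"

definition gasket_measure :: "(3 \<Rightarrow> real^2) \<Rightarrow> (real^2) measure" where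
  "gasket_measure q = (THE M.
     prob_space M \<and>
     sets M = sets (restrict_space borel (SG q)) \<and>
     (\<forall>A \<in> sets M. measure M A = (\<Sum>i\<in>UNIV. (1/3) * measure M (F q i -` A \<inter> SG q))) \<and>
     (\<forall>w. measure M (F_word q w ` SG q) = (1/3) ^ length w))"

text \<open>\<open>has_laplacian q u f\<close>: \<open>f\<close> is a representative of the \<open>L\<^sup>2\<close> class of the Laplacian of \<open>u\<close>.\<close>

definition has_laplacian ::
  "(3 \<Rightarrow> real^2) \<Rightarrow> (real^2 \<Rightarrow> real) \<Rightarrow> (real^2 \<Rightarrow> real) \<Rightarrow> bool" where
  "has_laplacian q u f \<longleftrightarrow>
     u \<in> dom_energy q \<and>
     f \<in> borel_measurable (gasket_measure q) \<and>
     integrable (gasket_measure q) (\<lambda>x. (f x)\<^sup>2) \<and>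
     (\<forall>v \<in> dom_energy q. (\<forall>x \<in> V q 0. v x = 0) \<longrightarrow>
        energy_form q u v = - (\<integral>x. f x * v x \<partial>gasket_measure q))"

definition dom_laplacian :: "(3 \<Rightarrow> real^2) \<Rightarrow> (real^2 \<Rightarrow> real) set" where
  "dom_laplacian q = {u. \<exists>f. has_laplacian q u f}"

text \<open>
  An arbitrary representative of the \<open>L\<^sup>2\<close> class; to be used only where null sets do not matter.
\<close>

definition laplacian :: "(3 \<Rightarrow> real^2) \<Rightarrow> (real^2 \<Rightarrow> real) \<Rightarrow> real^2 \<Rightarrow> real" where
  "laplacian q u = (SOME f. has_laplacian q u f)"

definition discrete_laplacian ::
  "(3 \<Rightarrow> real^2) \<Rightarrow> nat \<Rightarrow> (real^2 \<Rightarrow> real) \<Rightarrow> real^2 \<Rightarrow> real" where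
  "discrete_laplacian q m u z = (\<Sum>y | adjacent q m y z. u y - u z)"

end

(*
  Let P be the function that is harmonic on every cell of level m, vanishes on V_0 and solves
  14 P(z) + 4 sum_{y ~ z} P(y) = 45 * 5^m * Delta_m u(z) for z in V_m - V_0; this linear system is
  positive definite because its form is a sum over the cells of 3 sum c_i^2 + 4 (sum c_i)^2. Refining
  corner values explicitly, cell by cell, gives a function U with U = u on V_m whose Laplacian is P:
  the normal derivatives at the vertices of V_m - V_0 cancel exactly by the equation for P. As u - U
  vanishes on V_m and P is piecewise harmonic, E(u - U, P) = 0, so Delta u - P is orthogonal to P in
  L^2. Since U satisfies the same constraints as u, minimality gives |Delta u| <= |P| in L^2, and
  therefore Delta u = P almost everywhere.
*)

theory Submission
  imports Defs
begin

section \<open>Geometry of the gasket\<close>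

text \<open>The constants come from integrals of harmonic functions: over the whole gasket the
  square of h_i integrates to 7/45 and a product of two different h_i to 4/45. A function harmonic
  on a cell of level m with corner values p therefore pairs with the harmonic tent of corner i to (3
  p_i + 4 sum p) / (45 * 3^m). Dividing by the energy factor (5/3)^m leaves 5^m, and an interior
  vertex lies in two cells, so 7 becomes 14. These integrals are never computed here. The constants
  enter through an exact refinement rule for pairs of corner values and scaled Laplacian values,
  under which a discrete flux is conserved from level to level; the remaining term is a Riemann sum
  whose limit is the wanted integral. The vanishing of P on V_0 makes P itself an admissible test
  function. Two obstacles shape the rest. The gasket and its measure are definite descriptions, so
  existence and uniqueness come first. The Laplacian is only an L^2 class, so a continuous
  representative has to be exhibited, and test functions must be shown to determine the
  class.\<close>

definition words :: "nat \<Rightarrow> 3 list set" where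
  "words n = {w. length w = n}"

lemma finite_words [simp]: "finite (words n)"
  using finite_lists_length_eq[of "UNIV :: 3 set" n] by (simp add: words_def)

lemma words_0 [simp]: "words 0 = {[]}"
  by (auto simp: words_def)

lemma card_words [simp]: "card (words n) = 3 ^ n"
  using card_lists_length_eq[of "UNIV :: 3 set" n] by (simp add: words_def)

lemma sum_words_snoc: "(\<Sum>w\<in>words (Suc n). g w) = (\<Sum>w\<in>words n. \<Sum>i\<in>UNIV. g (w @ [i]))"
  unfolding sum.cartesian_product
  by (rule sum.reindex_bij_witness[of _ "\<lambda>(w, i). w @ [i]" "\<lambda>w. (butlast w, last w)"])
     (auto simp: words_def length_Suc_conv_rev)

lemma F_dist: "dist (F q i x) (F q i y) = dist x y / 2"
  by (simp add: F_def dist_norm flip: scaleR_diff_right)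

lemma F_inject [simp]: "F q i x = F q i y \<longleftrightarrow> x = y"
  by (simp add: F_def)

lemma F_fixed [simp]: "F q i (q i) = q i"
  by (simp add: F_def flip: scaleR_2)

lemma F_swap: "F q i (q j) = F q j (q i)"
  by (simp add: F_def add.commute)

lemma continuous_on_F: "continuous_on A (F q i)"
  unfolding F_def[abs_def] by (intro continuous_intros)

lemma F_word_append: "F_word q (v @ w) x = F_word q v (F_word q w x)"
  by (induction v) auto

lemma F_word_dist: "dist (F_word q w x) (F_word q w y) = dist x y / 2 ^ length w"
  by (induction w) (auto simp: F_dist)

lemma F_word_inject [simp]: "F_word q w x = F_word q w y \<longleftrightarrow> x = y"
  by (induction w) auto

lemma continuous_on_F_word: "continuous_on A (F_word q w)"
proof (induction w)
  case (Cons i w)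
  then show ?case
    using continuous_on_compose[OF _ continuous_on_F] by simp
qed (simp add: continuous_on_id')

definition corner :: "(3 \<Rightarrow> real^2) \<Rightarrow> 3 list \<Rightarrow> 3 \<Rightarrow> real^2" where
  "corner q w i = F_word q w (q i)"

lemma corner_Nil [simp]: "corner q [] i = q i"
  by (simp add: corner_def)

lemma corner_Cons [simp]: "corner q (a # w) i = F q a (corner q w i)"
  by (simp add: corner_def)

lemma corner_snoc_same [simp]: "corner q (w @ [i]) i = corner q w i"
  by (simp add: corner_def F_word_append)

text \<open>Both sides are the midpoint shared by the subcells \<open>i\<close> and
  \<open>j\<close>. All later gluing conditions have this form.\<close>

lemma corner_snoc_swap: "corner q (w @ [i]) j = corner q (w @ [j]) i"
  by (simp add: corner_def F_word_append F_swap[of q i])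

lemma F_word_replicate [simp]: "F_word q (replicate k i) (q i) = q i"
  by (induction k) auto

lemma corner_replicate [simp]: "corner q (w @ replicate k i) i = corner q w i"
  by (simp add: corner_def F_word_append)

lemma V_eq_corner: "V q m = (\<Union>w\<in>words m. range (corner q w))"
proof (induction m)
  case (Suc m)
  have "V q (Suc m) = (\<Union>a. \<Union>w\<in>words m. \<Union>i. {corner q (a # w) i})"
    by (simp add: Suc image_UN, blast)
  also have "\<dots> = (\<Union>w\<in>words (Suc m). range (corner q w))"
    by (fastforce simp: words_def length_Suc_conv)
  finally show ?case .
qed auto

lemma corner_in_V: "corner q w i \<in> V q (length w)"
  by (auto simp: V_eq_corner words_def)

lemma V_mono: "m \<le> n \<Longrightarrow> V q m \<subseteq> V q n"
proof (induction rule: dec_induct)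
  case (step n)
  have "V q n \<subseteq> V q (Suc n)"
  proof
    fix x assume "x \<in> V q n"
    then obtain w i where "w \<in> words n" "x = corner q w i"
      by (auto simp: V_eq_corner)
    then show "x \<in> V q (Suc n)"
      using corner_in_V[of q "w @ [i]" i] by (simp add: words_def)
  qed
  with step show ?case by blast
qed simp

lemma finite_V [simp]: "finite (V q m)"
  by (induction m) auto

locale gasket =
  fixes q :: "3 \<Rightarrow> real^2"
  assumes equilateral: "equilateral q"
begin

section \<open>Barycentric coordinates\<close>

lemma inj_q: "q i = q j \<longleftrightarrow> i = j"
  using equilateral by (force simp: equilateral_def)

lemma corner_inject [simp]: "corner q w i = corner q w j \<longleftrightarrow> i = j"
  by (simp add: corner_def inj_q)

text \<open>The affine coordinate belonging to \<open>q i\<close>. The vector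
  \<open>3 *\<^sub>R q i - (q 1 + q 2 + q 3)\<close> is three times the arrow from the centroid to
  \<open>q i\<close>; its inner product with \<open>q j - q i\<close> is minus 3/2 of the squared
  side, which fixes the factor. In the type \<open>3\<close> the index 3 is 0.\<close>

definition bary :: "3 \<Rightarrow> real^2 \<Rightarrow> real" where
  "bary i x = 1 + 2 / (3 * (dist (q 1) (q 2))\<^sup>2) * ((x - q i) \<bullet> (3 *\<^sub>R q i - (q 1 + q 2 + q 3)))"

lemma bary_affine: "bary i ((1/2) *\<^sub>R (x + y)) = (bary i x + bary i y) / 2"
  by (simp add: bary_def algebra_simps inner_simps add_divide_distrib diff_divide_distrib)

lemma bary_q: "bary i (q j) = (if i = j then 1 else 0)"
proof (cases "i = j")
  case False
  obtain d where d: "d > 0" "\<And>i j. i \<noteq> j \<Longrightarrow> dist (q i) (q j) = d"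
    using equilateral by (auto simp: equilateral_def)
  have sq: "q i \<bullet> q i + q j \<bullet> q j - 2 * (q i \<bullet> q j) = d\<^sup>2" if "i \<noteq> j" for i j
  proof -
    have "(norm (q i - q j))\<^sup>2 = d\<^sup>2"
      using d(2)[OF that] by (simp add: dist_norm)
    then show ?thesis
      by (simp only: power2_norm_eq_inner) (simp add: inner_simps inner_commute)
  qed
  have 12: "q 1 \<bullet> q 1 + q 2 \<bullet> q 2 - 2 * (q 1 \<bullet> q 2) = d\<^sup>2"
    and 13: "q 1 \<bullet> q 1 + q 3 \<bullet> q 3 - 2 * (q 1 \<bullet> q 3) = d\<^sup>2"
    and 23: "q 2 \<bullet> q 2 + q 3 \<bullet> q 3 - 2 * (q 2 \<bullet> q 3) = d\<^sup>2"
    using sq[of 1 2] sq[of 1 3] sq[of 2 3] by auto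
  have "(q j - q i) \<bullet> (3 *\<^sub>R q i - (q 1 + q 2 + q 3)) = - (3 / 2 * d\<^sup>2)"
    using exhaust_3[of i] exhaust_3[of j] False 12 13 23
    by (auto simp: inner_simps inner_commute)
  then show ?thesis
    using False d(1) d(2)[of 1 2] by (simp add: bary_def)
qed (simp add: bary_def)

lemma sum_bary: "(\<Sum>i\<in>UNIV. bary i x) = 1"
proof -
  have *: "a + b + c = a' + b' + c' \<Longrightarrow> (1 + r * a) + (1 + r * b) + (1 + r * c) =
      (1 + r * a') + (1 + r * b') + (1 + r * c')" for r a b c a' b' c' :: real
    by (simp add: distrib_left[symmetric])
  have "(\<Sum>i\<in>UNIV. bary i x) = (\<Sum>i\<in>UNIV. bary i (q 1))"
    unfolding sum_3 bary_def by (rule *) (simp add: inner_simps)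
  then show ?thesis
    by (simp add: bary_q)
qed

lemma bary_F: "bary i (F q k x) = (bary i x + (if i = k then 1 else 0)) / 2"
  by (simp add: F_def bary_affine bary_q)

lemma continuous_on_bary: "continuous_on A (bary i)"
  unfolding bary_def[abs_def] by (intro continuous_intros)

text \<open>Existence comes from the closure of all vertices. Uniqueness is a maximum argument: for
  invariant compact sets \<open>K\<close> and \<open>L\<close>, the point of \<open>K\<close>
  farthest from \<open>L\<close> is \<open>F q i y\<close> with \<open>y\<close> in
  \<open>K\<close>; applying \<open>F q i\<close> to the point of \<open>L\<close> nearest to
  \<open>y\<close> halves the distance, so the largest distance is at most half of itself.\<close>

lemma SG_properties:
  shows compact_SG: "compact (SG q)"
    and SG_nonempty: "SG q \<noteq> {}"
    and SG_self_similar: "SG q = (\<Union>i. F q i ` SG q)"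
    and SG_eq_closure: "SG q = closure (\<Union>m. V q m)"
proof -
  let ?V = "\<Union>m. V q m" and ?P = "\<lambda>K. compact K \<and> K \<noteq> {} \<and> K = (\<Union>i. F q i ` K)"
  define B where "B = Max (range (\<lambda>i. norm (q i)))"
  have B: "norm (q i) \<le> B" for i
    unfolding B_def by (rule Max_ge) auto
  have "norm x \<le> B" if "x \<in> V q m" for m x
    using that
  proof (induction m arbitrary: x)
    case (Suc m)
    then obtain i y where "x = F q i y" "norm y \<le> B"
      by auto
    then show ?case
      using B[of i] norm_triangle_ineq[of y "q i"] by (auto simp: F_def)
  qed (use B in auto)
  then have "bounded ?V"
    by (auto simp: bounded_iff)
  then have comp: "compact (closure ?V)"
    by simp
  have Fcl: "F q i ` closure A = closure (F q i ` A)" if "bounded A" for i A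
  proof (rule antisym)
    show "F q i ` closure A \<subseteq> closure (F q i ` A)"
      by (rule image_closure_subset[OF continuous_on_F]) (auto simp: closure_subset)
    have "compact (F q i ` closure A)"
      using that by (intro compact_continuous_image continuous_on_F) auto
    then show "closure (F q i ` A) \<subseteq> F q i ` closure A"
      by (intro closure_minimal image_mono closure_subset compact_imp_closed)
  qed
  have "?V = (\<Union>i. F q i ` ?V)"
  proof -
    have "?V = (\<Union>m. V q (Suc m))"
    proof (rule SUP_eq)
      fix i show "\<exists>j\<in>UNIV. V q i \<subseteq> V q (Suc j)"
        by (intro bexI[of _ i] V_mono) auto
    next
      fix i show "\<exists>j\<in>UNIV. V q (Suc i) \<subseteq> V q j"
        by (intro bexI[of _ "Suc i"] order_refl UNIV_I)
    qed
    also have "\<dots> = (\<Union>i. F q i ` ?V)"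
      by auto
    finally show ?thesis .
  qed
  then have "closure ?V = closure (\<Union>i. F q i ` ?V)"
    by (rule arg_cong)
  also have "\<dots> = (\<Union>i. F q i ` closure ?V)"
    by (simp only: Fcl[OF \<open>bounded ?V\<close>] UNIV_3 closure_Un UN_insert UN_empty closure_empty)
  finally have fix_V: "closure ?V = (\<Union>i. F q i ` closure ?V)" .
  have sub: "K \<subseteq> L" if "?P K" "?P L" for K L
  proof -
    have cl: "closed L" "L \<noteq> {}" using that by (auto intro: compact_imp_closed)
    have "continuous_on K (\<lambda>x. infdist x L)"
      by (intro continuous_intros)
    with that obtain x where x: "x \<in> K" "\<And>y. y \<in> K \<Longrightarrow> infdist y L \<le> infdist x L"
      using continuous_attains_sup[of K "\<lambda>x. infdist x L"] by blast
    from x(1) that obtain i y where y: "y \<in> K" "x = F q i y"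
      by blast
    obtain z where z: "z \<in> L" "infdist y L = dist y z"
      using infdist_attains_inf[OF cl] by blast
    have "F q i z \<in> L"
      using that z by blast
    then have "infdist x L \<le> dist y z / 2"
      using infdist_le[of "F q i z" L x] y by (simp add: F_dist)
    then have "infdist x L \<le> 0"
      using x(2)[OF y(1)] z by simp
    then have "infdist y L = 0" if "y \<in> K" for y
      using x(2)[OF that] infdist_nonneg[of y L] by linarith
    then show ?thesis
      using in_closed_iff_infdist_zero[OF cl] by blast
  qed
  have ne: "closure ?V \<noteq> {}"
    by (auto intro!: exI[of _ 0])
  have P: "?P (closure ?V)"
    using comp ne fix_V by blast
  have eq: "SG q = closure ?V"
    unfolding SG_def using P by (rule the_equality) (intro antisym sub P)
  show "compact (SG q)" "SG q \<noteq> {}" "SG q = (\<Union>i. F q i ` SG q)" "SG q = closure ?V"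
    unfolding eq by (fact comp ne fix_V refl)+
qed

lemma V_subset_SG: "V q m \<subseteq> SG q"
  unfolding SG_eq_closure by (rule order_trans[OF _ closure_subset]) blast

lemma corner_in_SG [simp]: "corner q w i \<in> SG q"
  using corner_in_V V_subset_SG by blast

lemma q_in_SG [simp]: "q i \<in> SG q"
  using corner_in_SG[of "[]" i] by simp

lemma F_in_SG: "x \<in> SG q \<Longrightarrow> F q i x \<in> SG q"
  using SG_self_similar by blast

lemma F_word_in_SG: "x \<in> SG q \<Longrightarrow> F_word q w x \<in> SG q"
  by (induction w) (auto simp: F_in_SG)

lemma SG_cover: "x \<in> SG q \<Longrightarrow> \<exists>w\<in>words n. x \<in> F_word q w ` SG q"
proof (induction n arbitrary: x)
  case (Suc n)
  then obtain i y where "y \<in> SG q" "x = F q i y"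
    using SG_self_similar by blast
  moreover obtain w where "w \<in> words n" "y \<in> F_word q w ` SG q"
    using Suc.IH \<open>y \<in> SG q\<close> by blast
  ultimately show ?case
    by (intro bexI[of _ "i # w"]) (auto simp: words_def)
qed auto

lemma bary_nonneg: "x \<in> SG q \<Longrightarrow> 0 \<le> bary i x"
proof -
  have "0 \<le> bary i x" if "x \<in> V q m" for m x
    using that by (induction m arbitrary: x) (auto simp: bary_q bary_F)
  then have "(\<Union>m. V q m) \<subseteq> {x. 0 \<le> bary i x}"
    by auto
  moreover have "closed {x. 0 \<le> bary i x}"
    by (intro closed_Collect_le continuous_intros continuous_on_bary)
  ultimately have "SG q \<subseteq> {x. 0 \<le> bary i x}"
    unfolding SG_eq_closure by (rule closure_minimal)
  then show "x \<in> SG q \<Longrightarrow> 0 \<le> bary i x"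
    by blast
qed

lemma bary_pair_le: "x \<in> SG q \<Longrightarrow> i \<noteq> j \<Longrightarrow> bary i x + bary j x \<le> 1"
proof -
  assume "x \<in> SG q" "i \<noteq> j"
  then have "(\<Sum>k\<in>{i, j}. bary k x) \<le> (\<Sum>k\<in>UNIV. bary k x)"
    by (intro sum_mono2) (auto simp: bary_nonneg)
  with \<open>i \<noteq> j\<close> show ?thesis by (simp add: sum_bary)
qed

lemma bary_le_1: "x \<in> SG q \<Longrightarrow> bary i x \<le> 1"
  using bary_pair_le[of x i "i + 1"] bary_nonneg[of x "i + 1"] by simp

section \<open>Intersections of cells\<close>

definition diam :: real where "diam = diameter (SG q)"

lemma dist_le_diam: "x \<in> SG q \<Longrightarrow> y \<in> SG q \<Longrightarrow> dist x y \<le> diam"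
  unfolding diam_def by (intro diameter_bounded_bound compact_imp_bounded compact_SG)

lemma eq_if_dist_le_pow:
  assumes "\<And>n. dist x y \<le> D / 2 ^ n"
  shows "x = (y :: real^2)"
proof -
  have "(\<lambda>n. D / 2 ^ n) \<longlonglongrightarrow> 0"
    by real_asymp
  then have "dist x y \<le> 0"
    using assms by (intro LIMSEQ_le_const) auto
  then show ?thesis by simp
qed

text \<open>Within the gasket, coordinate \<open>j\<close> can equal 1 only in the cell of
  \<open>F q j\<close>, at the image of a point with the same property. Iteration brings the point
  within \<open>diam / 2 ^ n\<close> of \<open>q j\<close> for every n.\<close>

lemma bary_eq_1D:
  assumes "x \<in> SG q" "bary j x = 1"
  shows "x = q j"
proof (rule eq_if_dist_le_pow)
  fix n show "dist x (q j) \<le> diam / 2 ^ n"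
    using assms
  proof (induction n arbitrary: x)
    case (Suc n)
    then obtain k y where y: "y \<in> SG q" "x = F q k y"
      using SG_self_similar by blast
    have k: "k = j" "bary j y = 1"
      using Suc.prems y bary_le_1[of y j] by (auto simp: bary_F split: if_splits)
    then have "dist x (q j) = dist y (q j) / 2"
      using F_dist[of q j y "q j"] y by simp
    then show ?case
      using Suc.IH[of y] y k by simp
  qed (use dist_le_diam in auto)
qed

text \<open>Coordinate \<open>i\<close> is at least 1/2 on cell \<open>i\<close>, coordinate
  \<open>j\<close> at least 1/2 on cell \<open>j\<close>, and two coordinates sum to at most 1. At a
  common point both equal 1/2, so each preimage has a coordinate equal to 1 and is a vertex.\<close>

lemma F_eq_F:
  assumes "F q i x = F q j y" "i \<noteq> j" "x \<in> SG q" "y \<in> SG q"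
  shows "x = q j \<and> y = q i"
proof -
  have *: "x = q j" if "F q i x = F q j y" "i \<noteq> j" "x \<in> SG q" "y \<in> SG q" for x y i j
  proof -
    have "bary i (F q i x) + bary j (F q j y) \<le> 1"
      using bary_pair_le[OF F_in_SG[OF that(3)] that(2), of i] that(1) by simp
    moreover have "bary j (F q i x) = bary j (F q j y)" "bary i (F q i x) = bary i (F q j y)"
      using that by simp_all
    ultimately have "bary j x = 1"
      using that(2) bary_nonneg[OF that(3), of i] bary_nonneg[OF that(4), of j]
        bary_le_1[OF that(3), of j]
      by (simp add: bary_F)
    then show ?thesis using bary_eq_1D that by blast
  qed
  show ?thesis using *[OF assms] *[OF assms(1)[symmetric] assms(2)[symmetric]] assms by simp
qed

lemma F_word_eq_q:
  assumes "F_word q w x = q b" "x \<in> SG q"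
  shows "w = replicate (length w) b \<and> x = q b"
  using assms(1)
proof (induction w)
  case (Cons i w)
  have "F q i (F_word q w x) = F q b (q b)"
    using Cons.prems by simp
  moreover have "i = b"
    using F_eq_F[OF calculation] F_word_in_SG[OF assms(2)] inj_q by auto
  ultimately have "F_word q w x = q b" "i = b"
    by (simp_all only: F_inject)
  then show ?case
    using Cons.IH by simp
qed (use assms in auto)

text \<open>At the first letters \<open>a\<close> and \<open>b\<close> in which the words differ,
  \<open>F_eq_F\<close> sends both tails to boundary vertices, and \<open>F_word_eq_q\<close> then
  makes the tails constant. This parallels the two binary expansions of a dyadic number.\<close>

lemma F_word_eq_F_word:
  assumes "F_word q w x = F_word q w' y" "length w = length w'" "w \<noteq> w'" "x \<in> SG q" "y \<in> SG q"
  obtains v a b k where "a \<noteq> b" "w = v @ a # replicate k b" "w' = v @ b # replicate k a"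
    "x = q b" "y = q a"
proof -
  have "\<exists>v a b k. a \<noteq> b \<and> w = v @ a # replicate k b \<and> w' = v @ b # replicate k a \<and> x = q b \<and> y = q a"
    using assms(2,1,3)
  proof (induction w w' rule: list_induct2)
    case (Cons a w b w')
    show ?case
    proof (cases "a = b")
      case True
      with Cons obtain v c d k where "c \<noteq> d" "w = v @ c # replicate k d"
        "w' = v @ d # replicate k c" "x = q d" "y = q c" by auto
      then show ?thesis
        using True by (intro exI[of _ "a # v"] exI[of _ c] exI[of _ d] exI[of _ k]) simp
    next
      case False
      then have "F_word q w x = q b \<and> F_word q w' y = q a"
        using F_eq_F[of a "F_word q w x" b "F_word q w' y"] Cons.prems
          F_word_in_SG assms(4,5) by simp
      then have "w = replicate (length w) b \<and> x = q b" "w' = replicate (length w) a \<and> y = q a"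
        using F_word_eq_q[of w x b] F_word_eq_q[of w' y a] assms(4,5) Cons.hyps by simp_all
      then show ?thesis
        using False by (intro exI[of _ "[]"] exI[of _ a] exI[of _ b] exI[of _ "length w"]) simp
    qed
  qed simp
  then show ?thesis using that by blast
qed

lemma corner_eq_corner:
  assumes "corner q w i = corner q w' j" "length w = length w'"
  shows "w = w' \<and> i = j \<or>
    (\<exists>v k. i \<noteq> j \<and> w = v @ j # replicate k i \<and> w' = v @ i # replicate k j)"
proof (cases "w = w'")
  case False
  show ?thesis
    using assms(1) unfolding corner_def
    by (rule F_word_eq_F_word[OF _ assms(2) False]) (auto simp: inj_q)
qed (use assms in auto)

end


section \<open>The self-similar measure\<close>

lemma closed_indicator_limit:
  fixes C :: "'a :: metric_space set"
  assumes "closed C"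
  obtains \<phi> :: "nat \<Rightarrow> 'a \<Rightarrow> real"
  where "\<And>k A. continuous_on A (\<phi> k)" "\<And>k x. 0 \<le> \<phi> k x" "\<And>k x. \<phi> k x \<le> 1"
    "\<And>k x. x \<in> C \<Longrightarrow> \<phi> k x = 1" "\<And>x. (\<lambda>k. \<phi> k x) \<longlonglongrightarrow> indicator C x"
proof (cases "C = {}")
  case True
  then show ?thesis
    by (intro that[of "\<lambda>_ _. 0"]) auto
next
  case False
  show ?thesis
  proof (rule that[of "\<lambda>k x. max 0 (1 - real k * infdist x C)"])
    fix x
    show "(\<lambda>k. max 0 (1 - real k * infdist x C)) \<longlonglongrightarrow> indicator C x"
    proof (cases "x \<in> C")
      case True
      then show ?thesis
        by (simp add: infdist_zero)
    next
      case x: False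
      then have "infdist x C > 0"
        using in_closed_iff_infdist_zero[OF assms False] infdist_nonneg[of x C] by force
      moreover have "\<forall>\<^sub>F k in sequentially. 1 / infdist x C < real k"
        using filterlim_real_sequentially by (simp add: filterlim_at_top_dense)
      ultimately have "\<forall>\<^sub>F k in sequentially. max 0 (1 - real k * infdist x C) = 0"
        by (auto elim!: eventually_mono simp: field_simps)
      then show ?thesis
        using x by (simp add: tendsto_eventually)
    qed
  qed (auto intro!: continuous_intros infdist_nonneg mult_nonneg_nonneg simp: infdist_zero)
qed

lemma divide_power_2_tendsto_0: "(\<lambda>n. c / 2 ^ n) \<longlonglongrightarrow> (0 :: real)"
  by real_asymp

context gasket
begin

section \<open>Riemann sums over cells and uniqueness of the measure\<close>

lemma compact_cell: "compact (F_word q w ` SG q)"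
  by (intro compact_continuous_image continuous_on_F_word compact_SG)

lemma cell_subset: "F_word q w ` SG q \<subseteq> SG q"
  using F_word_in_SG by auto

lemma cell_oscillation:
  fixes \<phi> :: "real^2 \<Rightarrow> real"
  assumes "continuous_on (SG q) \<phi>" "e > 0"
  shows "\<exists>N. \<forall>n\<ge>N. \<forall>w\<in>words n. \<forall>x\<in>F_word q w ` SG q. \<forall>y\<in>F_word q w ` SG q. \<bar>\<phi> x - \<phi> y\<bar> < e"
proof -
  have "uniformly_continuous_on (SG q) \<phi>"
    using assms(1) compact_SG by (rule compact_uniformly_continuous)
  then obtain d where d: "d > 0"
    "\<And>x y. x \<in> SG q \<Longrightarrow> y \<in> SG q \<Longrightarrow> dist x y < d \<Longrightarrow> \<bar>\<phi> x - \<phi> y\<bar> < e"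
    using assms(2) unfolding uniformly_continuous_on_def dist_real_def by metis
  have "\<forall>\<^sub>F n in sequentially. diam / 2 ^ n < d"
    using divide_power_2_tendsto_0 d(1) by (rule order_tendstoD)
  then obtain N where N: "\<And>n. n \<ge> N \<Longrightarrow> diam / 2 ^ n < d"
    by (auto simp: eventually_sequentially)
  have "\<bar>\<phi> (F_word q w x) - \<phi> (F_word q w y)\<bar> < e"
    if "n \<ge> N" "w \<in> words n" "x \<in> SG q" "y \<in> SG q" for n w x y
  proof (rule d(2))
    have "dist x y / 2 ^ n \<le> diam / 2 ^ n"
      using that dist_le_diam by (intro divide_right_mono) auto
    then show "dist (F_word q w x) (F_word q w y) < d"
      using that N[of n] by (simp add: F_word_dist words_def)
  qed (use that F_word_in_SG in auto)
  then show ?thesis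
    by (intro exI[of _ N]) auto
qed

text \<open>The masses of the cells alone, without the invariance identity: they already fix the
  integral of every continuous function as a limit of cell sums.\<close>

definition cell_measure :: "(real^2) measure \<Rightarrow> bool" where
  "cell_measure M \<longleftrightarrow> prob_space M \<and> sets M = sets (restrict_space borel (SG q)) \<and>
     (\<forall>w. measure M (F_word q w ` SG q) = (1/3) ^ length w)"

lemma sets_restrict_SG: "A \<in> sets (restrict_space borel (SG q)) \<longleftrightarrow> A \<subseteq> SG q \<and> A \<in> sets borel"
  using compact_SG by (subst sets_restrict_space_iff) (auto intro: borel_compact)

lemma cell_measurable: "F_word q w ` SG q \<in> sets (restrict_space borel (SG q))"
  using compact_cell cell_subset by (auto simp: sets_restrict_SG intro!: borel_compact)

lemma continuous_measurable:
  assumes "sets M = sets (restrict_space borel (SG q))" "continuous_on (SG q) \<phi>"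
  shows "\<phi> \<in> borel_measurable M"
  using borel_measurable_continuous_on_restrict[OF assms(2)] assms(1) measurable_cong_sets by blast

lemma continuous_bounded:
  fixes \<phi> :: "real^2 \<Rightarrow> real"
  assumes "continuous_on (SG q) \<phi>"
  obtains B where "B \<ge> 0" "\<And>x. x \<in> SG q \<Longrightarrow> \<bar>\<phi> x\<bar> \<le> B"
proof -
  have "bounded (\<phi> ` SG q)"
    using assms compact_SG by (intro compact_imp_bounded compact_continuous_image)
  then show ?thesis
    using that by (auto simp: bounded_pos intro: less_imp_le)
qed

lemma continuous_integrable:
  fixes \<phi> :: "real^2 \<Rightarrow> real"
  assumes "cell_measure M" "continuous_on (SG q) \<phi>"
  shows "integrable M \<phi>"
proof -
  interpret prob_space M using assms(1) by (simp add: cell_measure_def)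
  have M: "sets M = sets (restrict_space borel (SG q))"
    using assms(1) by (simp add: cell_measure_def)
  obtain B where "\<And>x. x \<in> SG q \<Longrightarrow> \<bar>\<phi> x\<bar> \<le> B"
    using continuous_bounded[OF assms(2)] by metis
  moreover have "space M = SG q"
    using sets_eq_imp_space_eq[OF M] by (simp add: space_restrict_space)
  ultimately show ?thesis
    using continuous_measurable[OF M assms(2)] by (intro integrable_const_bound[of _ B]) auto
qed

text \<open>The cells of one level cover the gasket and their measures add up to \<open>1\<close>, so almost every
  point lies in exactly one of them.\<close>

lemma AE_one_cell:
  assumes "cell_measure M"
  shows "AE x in M. (\<Sum>w\<in>words n. indicator (F_word q w ` SG q) x) = (1 :: real)"
proof -
  interpret prob_space M using assms by (simp add: cell_measure_def)
  have M: "sets M = sets (restrict_space borel (SG q))"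
    using assms by (simp add: cell_measure_def)
  have sp: "space M = SG q"
    using sets_eq_imp_space_eq[OF M] by (simp add: space_restrict_space)
  have [measurable]: "F_word q w ` SG q \<in> sets M" for w
    using cell_measurable M by blast
  let ?g = "\<lambda>x. (\<Sum>w\<in>words n. indicator (F_word q w ` SG q) x) - (1 :: real)"
  have int: "integrable M ?g"
    by (auto intro!: Bochner_Integration.integrable_diff Bochner_Integration.integrable_sum
        simp: emeasure_eq_measure)
  have "integral\<^sup>L M ?g = (\<Sum>w\<in>words n. measure M (F_word q w ` SG q)) - 1"
    by (subst Bochner_Integration.integral_diff)
       (auto intro!: Bochner_Integration.integrable_sum
         simp: emeasure_eq_measure prob_space[unfolded sp] Int_absorb2 sp cell_subset)
  also have "\<dots> = (\<Sum>w\<in>words n. (1/3) ^ n) - 1"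
    using assms by (simp add: cell_measure_def words_def)
  also have "\<dots> = 0"
    by (simp add: power_one_over)
  finally have "integral\<^sup>L M ?g = 0" .
  moreover have "AE x in M. 0 \<le> ?g x"
  proof (rule AE_I2)
    fix x assume "x \<in> space M"
    then obtain w where "w \<in> words n" "x \<in> F_word q w ` SG q"
      using SG_cover sp by blast
    then show "0 \<le> ?g x"
      using member_le_sum[of w "words n" "\<lambda>w. indicator (F_word q w ` SG q) x :: real"] by simp
  qed
  ultimately have "AE x in M. ?g x = 0"
    using integral_nonneg_eq_0_iff_AE[OF int] by simp
  then show ?thesis
    by simp
qed

text \<open>The number \<open>g w\<close> need not be a value of \<open>\<phi>\<close>; uniform
  closeness to \<open>\<phi>\<close> on the cell suffices. This freedom admits products of two
  functions sampled at different corners.\<close>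

lemma Riemann_sum_tendsto:
  fixes \<phi> :: "real^2 \<Rightarrow> real" and g :: "3 list \<Rightarrow> real"
  assumes M: "cell_measure M" and \<phi>: "continuous_on (SG q) \<phi>"
    and g: "\<And>e. e > 0 \<Longrightarrow>
      \<exists>N. \<forall>n\<ge>N. \<forall>w\<in>words n. \<forall>x\<in>F_word q w ` SG q. \<bar>\<phi> x - g w\<bar> < e"
  shows "(\<lambda>n. (\<Sum>w\<in>words n. g w) / 3 ^ n) \<longlonglongrightarrow> (\<integral>x. \<phi> x \<partial>M)"
proof (rule LIMSEQ_I)
  interpret prob_space M using M by (simp add: cell_measure_def)
  have sets: "sets M = sets (restrict_space borel (SG q))"
    using M by (simp add: cell_measure_def)
  have sp: "space M = SG q"
    using sets_eq_imp_space_eq[OF sets] by (simp add: space_restrict_space)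
  have cell[measurable]: "F_word q w ` SG q \<in> sets M" for w
    using cell_measurable sets by blast
  have [measurable]: "\<phi> \<in> borel_measurable M"
    using continuous_measurable[OF sets \<phi>] .
  let ?I = "\<lambda>w x. indicator (F_word q w ` SG q) x :: real"
  have int_I: "integrable M (?I w)" for w
    by (simp add: emeasure_eq_measure)
  have int_\<phi>: "integrable M (\<lambda>x. \<phi> x * ?I w x)" for w
    by (intro integrable_real_mult_indicator cell continuous_integrable M \<phi>)
  have meas: "(\<integral>x. ?I w x \<partial>M) = 1 / 3 ^ n" if "w \<in> words n" for w n
    using M that by (simp add: cell_measure_def words_def power_one_over Int_absorb2 sp cell_subset)
  fix e :: real assume "e > 0"
  then obtain N where N:
    "\<And>n w x. n \<ge> N \<Longrightarrow> w \<in> words n \<Longrightarrow> x \<in> F_word q w ` SG q \<Longrightarrow> \<bar>\<phi> x - g w\<bar> < e / 2"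
    using g[of "e / 2"] by auto
  have "norm ((\<Sum>w\<in>words n. g w) / 3 ^ n - (\<integral>x. \<phi> x \<partial>M)) < e" if n: "n \<ge> N" for n
  proof -
    \<comment> \<open>The indicators of the cells of one level sum to 1 almost everywhere, so the
      integral splits exactly although the cells overlap.\<close>
    have "(\<integral>x. \<phi> x \<partial>M) = (\<integral>x. (\<Sum>w\<in>words n. \<phi> x * ?I w x) \<partial>M)"
      using AE_one_cell[OF M, of n]
      by (intro integral_cong_AE) (auto simp flip: sum_distrib_left)
    also have "\<dots> = (\<Sum>w\<in>words n. \<integral>x. \<phi> x * ?I w x \<partial>M)"
      by (intro Bochner_Integration.integral_sum int_\<phi>)
    finally have "(\<Sum>w\<in>words n. g w) / 3 ^ n - (\<integral>x. \<phi> x \<partial>M) =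
        (\<Sum>w\<in>words n. g w * (\<integral>x. ?I w x \<partial>M) - (\<integral>x. \<phi> x * ?I w x \<partial>M))"
      by (simp only: sum_subtractf sum_divide_distrib meas cong: sum.cong) simp
    also have "\<bar>\<dots>\<bar> \<le> (\<Sum>w\<in>words n. e / 2 * (1 / 3 ^ n))"
    proof (rule order_trans[OF sum_abs sum_mono])
      fix w assume w: "w \<in> words n"
      have "g w * (\<integral>x. ?I w x \<partial>M) - (\<integral>x. \<phi> x * ?I w x \<partial>M) =
          (\<integral>x. g w * ?I w x - \<phi> x * ?I w x \<partial>M)"
        using int_I int_\<phi> by simp
      also have "\<bar>\<dots>\<bar> \<le> (\<integral>x. \<bar>g w * ?I w x - \<phi> x * ?I w x\<bar> \<partial>M)"
        by (rule integral_abs_bound)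
      also have "\<dots> \<le> (\<integral>x. e / 2 * ?I w x \<partial>M)"
        using N[OF n w]
        by (intro integral_mono integrable_abs Bochner_Integration.integrable_diff
            integrable_mult_right int_I int_\<phi>)
           (auto split: split_indicator simp: abs_minus_commute intro!: less_imp_le)
      also have "\<dots> = e / 2 * (1 / 3 ^ n)"
        using meas[OF w] by simp
      finally show "\<bar>g w * (\<integral>x. ?I w x \<partial>M) - (\<integral>x. \<phi> x * ?I w x \<partial>M)\<bar> \<le> e / 2 * (1 / 3 ^ n)" .
    qed
    also have "\<dots> = e / 2"
      by simp
    also have "\<dots> < e"
      using \<open>e > 0\<close> by simp
    finally show ?thesis by simp
  qed
  then show "\<exists>no. \<forall>n\<ge>no. norm ((\<Sum>w\<in>words n. g w) / 3 ^ n - (\<integral>x. \<phi> x \<partial>M)) < e"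
    by blast
qed

lemma Riemann_sum_corner_tendsto:
  fixes \<phi> :: "real^2 \<Rightarrow> real"
  assumes "cell_measure M" "continuous_on (SG q) \<phi>"
  shows "(\<lambda>n. (\<Sum>w\<in>words n. \<phi> (corner q w i)) / 3 ^ n) \<longlonglongrightarrow> (\<integral>x. \<phi> x \<partial>M)"
proof (rule Riemann_sum_tendsto[OF assms])
  fix e :: real assume "e > 0"
  then obtain N where "\<forall>n\<ge>N. \<forall>w\<in>words n. \<forall>x\<in>F_word q w ` SG q. \<forall>y\<in>F_word q w ` SG q. \<bar>\<phi> x - \<phi> y\<bar> < e"
    using cell_oscillation[OF assms(2)] by blast
  then show "\<exists>N. \<forall>n\<ge>N. \<forall>w\<in>words n. \<forall>x\<in>F_word q w ` SG q. \<bar>\<phi> x - \<phi> (corner q w i)\<bar> < e"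
    by (intro exI[of _ N]) (auto simp: corner_def)
qed

text \<open>The source term of a spline multiplies a value at one corner of a cell by a value at
  another corner. Uniform continuity makes the choice of corners irrelevant in the limit.\<close>

lemma Riemann_sum_product_tendsto:
  fixes p v :: "real^2 \<Rightarrow> real"
  assumes "cell_measure M" and p: "continuous_on (SG q) p" and v: "continuous_on (SG q) v"
  shows "(\<lambda>n. (\<Sum>w\<in>words n. p (corner q w i) * v (corner q w j)) / 3 ^ n) \<longlonglongrightarrow> (\<integral>x. p x * v x \<partial>M)"
proof (rule Riemann_sum_tendsto[OF assms(1)])
  fix e :: real assume e: "e > 0"
  obtain B where B: "B \<ge> 0" "\<And>x. x \<in> SG q \<Longrightarrow> \<bar>p x\<bar> \<le> B"
    using continuous_bounded[OF p] by metis
  obtain C where C: "C \<ge> 0" "\<And>x. x \<in> SG q \<Longrightarrow> \<bar>v x\<bar> \<le> C"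
    using continuous_bounded[OF v] by metis
  \<comment> \<open>The error will be at most \<open>B * d + d * C\<close>; the added 1 keeps the
    denominator positive and the final estimate strict.\<close>
  define d where "d = e / (B + C + 1)"
  have d: "d > 0"
    using e B(1) C(1) by (simp add: d_def)
  obtain N1 where N1: "\<And>n w x y. \<lbrakk>n \<ge> N1; w \<in> words n; x \<in> F_word q w ` SG q; y \<in> F_word q w ` SG q\<rbrakk>
      \<Longrightarrow> \<bar>p x - p y\<bar> < d"
    using cell_oscillation[OF p d] by metis
  obtain N2 where N2: "\<And>n w x y. \<lbrakk>n \<ge> N2; w \<in> words n; x \<in> F_word q w ` SG q; y \<in> F_word q w ` SG q\<rbrakk>
      \<Longrightarrow> \<bar>v x - v y\<bar> < d"
    using cell_oscillation[OF v d] by metis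
  have "\<bar>p x * v x - p (corner q w i) * v (corner q w j)\<bar> < e"
    if n: "n \<ge> max N1 N2" and w: "w \<in> words n" and x: "x \<in> F_word q w ` SG q" for n w x
  proof -
    have c: "corner q w k \<in> F_word q w ` SG q" for k
      by (simp add: corner_def)
    have "p x * v x - p (corner q w i) * v (corner q w j) =
        p x * (v x - v (corner q w j)) + (p x - p (corner q w i)) * v (corner q w j)"
      by (simp add: algebra_simps)
    also have "\<bar>\<dots>\<bar> \<le> \<bar>p x\<bar> * \<bar>v x - v (corner q w j)\<bar> + \<bar>p x - p (corner q w i)\<bar> * \<bar>v (corner q w j)\<bar>"
      by (metis abs_mult abs_triangle_ineq)
    also have "\<dots> \<le> B * d + d * C"
      using N1[OF _ w x c[of i]] N2[OF _ w x c[of j]] B C n x cell_subset[of w] d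
      by (intro add_mono mult_mono) (auto intro: less_imp_le)
    also have "\<dots> < d * (B + C + 1)"
      using d by (simp add: algebra_simps)
    also have "\<dots> = e"
      using B(1) C(1) by (simp add: d_def)
    finally show ?thesis .
  qed
  then show "\<exists>N. \<forall>n\<ge>N. \<forall>w\<in>words n. \<forall>x\<in>F_word q w ` SG q.
      \<bar>p x * v x - p (corner q w i) * v (corner q w j)\<bar> < e"
    by blast
qed (intro continuous_intros p v)

text \<open>Integrals of continuous functions agree, being limits of the same cell sums. Distance
  cut-offs carry this over to closed sets, which are stable under intersection and generate the
  Borel sets.\<close>

lemma cell_measure_unique:
  assumes M: "cell_measure M" and N: "cell_measure N"
  shows "M = N"
proof -
  interpret M: prob_space M using M by (simp add: cell_measure_def)
  interpret N: prob_space N using N by (simp add: cell_measure_def)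
  have sM: "sets M = sets (restrict_space borel (SG q))" and sN: "sets N = sets (restrict_space borel (SG q))"
    using M N by (simp_all add: cell_measure_def)
  have sp: "space M = SG q" "space N = SG q"
    using sets_eq_imp_space_eq[OF sM] sets_eq_imp_space_eq[OF sN] by (simp_all add: space_restrict_space)
  have mM: "(\<lambda>x. x) \<in> measurable M borel" and mN: "(\<lambda>x. x) \<in> measurable N borel"
    using continuous_measurable[OF sM] continuous_measurable[OF sN] by (auto intro!: continuous_intros)
  have closed_eq: "measure M (C \<inter> SG q) = measure N (C \<inter> SG q)" if C: "closed C" for C
  proof -
    obtain \<phi> :: "nat \<Rightarrow> real^2 \<Rightarrow> real" where \<phi>: "\<And>k A. continuous_on A (\<phi> k)"
      "\<And>k x. 0 \<le> \<phi> k x" "\<And>k x. \<phi> k x \<le> 1" "\<And>x. (\<lambda>k. \<phi> k x) \<longlonglongrightarrow> indicator C x"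
      using closed_indicator_limit[OF C] by metis
    have lim: "(\<lambda>k. \<integral>x. \<phi> k x \<partial>L) \<longlonglongrightarrow> measure L (C \<inter> SG q)" if L: "cell_measure L" for L
    proof -
      interpret L: prob_space L using L by (simp add: cell_measure_def)
      have sL: "sets L = sets (restrict_space borel (SG q))"
        using L by (simp add: cell_measure_def)
      have spL: "space L = SG q"
        using sets_eq_imp_space_eq[OF sL] by (simp add: space_restrict_space)
      have [measurable]: "\<phi> k \<in> borel_measurable L" for k
        using continuous_measurable[OF sL \<phi>(1)] .
      have "(\<lambda>x. x) \<in> measurable L borel"
        using continuous_measurable[OF sL] by (auto intro!: continuous_intros)
      from measurable_compose[OF this borel_measurable_indicator[of C borel]]
      have [measurable]: "indicator C \<in> borel_measurable L"
        using C by simp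
      have "(\<lambda>k. \<integral>x. \<phi> k x \<partial>L) \<longlonglongrightarrow> (\<integral>x. indicator C x \<partial>L)"
        using \<phi> by (intro integral_dominated_convergence[where w = "\<lambda>_. 1"]) auto
      then show ?thesis
        by (simp add: spL)
    qed
    have "(\<integral>x. \<phi> k x \<partial>M) = (\<integral>x. \<phi> k x \<partial>N)" for k
      using Riemann_sum_corner_tendsto[OF M \<phi>(1)] Riemann_sum_corner_tendsto[OF N \<phi>(1)]
      by (rule LIMSEQ_unique)
    then show ?thesis
      using LIMSEQ_unique[OF lim[OF M]] lim[OF N] by simp
  qed
  \<comment> \<open>The closed sets generate the Borel sets of the whole plane, so both measures are
    first transported there from the gasket.\<close>
  have "distr M borel (\<lambda>x. x) = distr N borel (\<lambda>x. x)"
  proof (rule measure_eqI_generator_eq[of "Collect closed" UNIV _ _ "\<lambda>_. UNIV"])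
    show "Int_stable (Collect closed :: (real^2) set set)"
      by (auto simp: Int_stable_def)
    fix C :: "(real^2) set" assume "C \<in> Collect closed"
    then show "emeasure (distr M borel (\<lambda>x. x)) C = emeasure (distr N borel (\<lambda>x. x)) C"
      using closed_eq mM mN by (simp add: emeasure_distr M.emeasure_eq_measure N.emeasure_eq_measure sp)
  qed (use mM mN in \<open>auto simp: borel_eq_closed emeasure_distr M.emeasure_eq_measure\<close>)
  then have eq: "emeasure (distr M borel (\<lambda>x. x)) A = emeasure (distr N borel (\<lambda>x. x)) A" for A
    by simp
  show ?thesis
  proof (rule measure_eqI)
    fix A assume "A \<in> sets M"
    then have "A \<in> sets borel" "A \<subseteq> SG q"
      unfolding sM sets_restrict_SG by auto
    then show "emeasure M A = emeasure N A"
      using eq[of A] mM mN by (simp add: emeasure_distr sp Int_absorb2)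
  qed (simp add: sM sN)
qed

section \<open>Existence of the measure as the law of a random address\<close>

definition code :: "3 stream \<Rightarrow> real^2" where
  "code s = (\<Sum>n. (1/2) ^ Suc n *\<^sub>R q (s !! n))"

lemma summable_code: "summable (\<lambda>n. (1/2) ^ Suc n *\<^sub>R q (s !! n))"
proof (rule summable_comparison_test')
  show "summable (\<lambda>n. Max (range (\<lambda>i. norm (q i))) * (1/2) ^ Suc n)"
    by (intro summable_mult) (simp add: summable_geometric)
  fix n show "norm ((1/2) ^ Suc n *\<^sub>R q (s !! n)) \<le> Max (range (\<lambda>i. norm (q i))) * (1/2) ^ Suc n"
    by (simp add: mult.commute divide_right_mono Max_ge)
qed

lemma norm_code_le: "norm (code s) \<le> Max (range (\<lambda>i. norm (q i)))"
proof -
  let ?B = "Max (range (\<lambda>i. norm (q i)))"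
  have "(\<lambda>n. (1/2 :: real) ^ Suc n) sums 1"
    using power_half_series .
  then have s: "(\<lambda>n. ?B * (1/2) ^ Suc n) sums ?B"
    using sums_mult by fastforce
  have "norm (code s) \<le> (\<Sum>n. ?B * (1/2) ^ Suc n)"
    unfolding code_def
    by (rule norm_suminf_le[OF _ sums_summable[OF s]])
       (simp add: mult.commute divide_right_mono Max_ge)
  also have "\<dots> = ?B"
    using s by (simp add: sums_iff)
  finally show ?thesis .
qed

lemma code_Stream: "code (i ## s) = F q i (code s)"
proof -
  have "(\<Sum>n. (1/2) ^ Suc (Suc n) *\<^sub>R q (s !! n)) = code (i ## s) - (1/2) *\<^sub>R q i"
    using suminf_split_head[OF summable_code[of "i ## s"]] by (simp add: code_def)
  moreover have "(\<Sum>n. (1/2) ^ Suc (Suc n) *\<^sub>R q (s !! n)) = (1/2) *\<^sub>R code s"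
    using suminf_scaleR_right[OF summable_code[of s], of "1/2"] by (simp add: code_def)
  ultimately show ?thesis
    by (simp add: F_def algebra_simps)
qed

lemma code_split: "code s = F_word q (stake n s) (code (sdrop n s))"
proof (induction n arbitrary: s)
  case (Suc n)
  show ?case
    using code_Stream[of "shd s" "stl s"] Suc[of "stl s"] by simp
qed simp

text \<open>A corner of the cell given by the first n letters lies within \<open>D / 2 ^ n\<close>
  of the point, and the gasket is closed.\<close>

lemma code_in_SG: "code s \<in> SG q"
proof -
  obtain D where D: "\<And>s. dist (code s) (q 1) \<le> D"
    using norm_triangle_le_diff[OF add_mono[OF norm_code_le order_refl]] by (metis dist_norm)
  have "infdist (code s) (SG q) \<le> D / 2 ^ n" for n
  proof -
    have "infdist (code s) (SG q) \<le> dist (code s) (corner q (stake n s) 1)"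
      by (rule infdist_le) simp
    also have "\<dots> = dist (code (sdrop n s)) (q 1) / 2 ^ n"
      by (subst code_split[of s n]) (simp add: corner_def F_word_dist)
    also have "\<dots> \<le> D / 2 ^ n"
      using D by (simp add: divide_right_mono)
    finally show ?thesis .
  qed
  then have "infdist (code s) (SG q) \<le> 0"
    using divide_power_2_tendsto_0[of D] by (intro LIMSEQ_le_const) auto
  then show ?thesis
    using in_closed_iff_infdist_zero[of "SG q"] compact_imp_closed[OF compact_SG] SG_nonempty
      infdist_nonneg[of "code s" "SG q"] by simp
qed

text \<open>The measure is the law of \<open>code\<close> for independent uniform letters. Splitting
  off the first letter, \<open>code_Stream\<close> turns the product structure of the stream space
  into the invariance identity.\<close>

lemma self_similar_measure_exists:
  "\<exists>M. prob_space M \<and> sets M = sets (restrict_space borel (SG q)) \<and>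
     (\<forall>A\<in>sets M. measure M A = (\<Sum>i\<in>UNIV. (1/3) * measure M (F q i -` A \<inter> SG q)))"
proof -
  define P where "P = measure_pmf (pmf_of_set (UNIV :: 3 set))"
  interpret P: prob_space P
    unfolding P_def by (rule measure_pmf.prob_space_axioms)
  define S where "S = stream_space P"
  interpret S: prob_space S
    unfolding S_def by (rule P.prob_space_stream_space)
  have spS: "space S = UNIV"
    by (simp add: S_def P_def space_stream_space)
  have "(\<lambda>x. x !! n) \<in> measurable S (count_space UNIV)" for n
    using measurable_snth[of n P] by (simp add: S_def P_def)
  from measurable_compose[OF this, of q borel]
  have [measurable]: "(\<lambda>x. q (x !! n)) \<in> borel_measurable S" for n
    by simp
  have [measurable]: "code \<in> borel_measurable S"
    unfolding code_def[abs_def] by measurable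
  have code: "code \<in> measurable S (restrict_space borel (SG q))"
    by (intro measurable_restrict_space2) (auto simp: code_in_SG)
  let ?M = "distr S (restrict_space borel (SG q)) code"
  have m: "measure ?M A = measure S (code -` A)" if "A \<in> sets (restrict_space borel (SG q))" for A
    using measure_distr[OF code that] spS by simp
  have "measure ?M A = (\<Sum>i\<in>UNIV. (1/3) * measure ?M (F q i -` A \<inter> SG q))"
    if A: "A \<in> sets ?M" for A
  proof -
    have A': "A \<in> sets (restrict_space borel (SG q))" "A \<in> sets borel"
      using A by (auto simp: sets_restrict_SG)
    have "F q i \<in> borel_measurable borel" for i
      by (intro borel_measurable_continuous_onI continuous_on_F)
    from measurable_sets[OF this A'(2)]
    have FA: "F q i -` A \<inter> SG q \<in> sets (restrict_space borel (SG q))" for i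
      using borel_compact[OF compact_SG] by (simp add: sets_restrict_SG)
    have X: "code -` A \<in> sets S"
      using measurable_sets[OF code A'(1)] spS by simp
    have "ennreal (measure S (code -` A)) = emeasure S (code -` A)"
      by (simp add: S.emeasure_eq_measure)
    also have "\<dots> = (\<integral>\<^sup>+i. emeasure S {s\<in>space S. i ## s \<in> code -` A} \<partial>P)"
      unfolding S_def by (rule P.emeasure_stream_space) (use X in \<open>simp add: S_def\<close>)
    also have "\<dots> = (\<integral>\<^sup>+i. ennreal (measure ?M (F q i -` A \<inter> SG q)) \<partial>P)"
    proof (rule nn_integral_cong)
      fix i
      have "{s\<in>space S. i ## s \<in> code -` A} = code -` (F q i -` A \<inter> SG q)"
        by (auto simp: code_Stream spS code_in_SG)
      then show "emeasure S {s\<in>space S. i ## s \<in> code -` A} = ennreal (measure ?M (F q i -` A \<inter> SG q))"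
        using m[OF FA, of i] by (simp add: S.emeasure_eq_measure)
    qed
    also have "\<dots> = (\<Sum>i\<in>UNIV. ennreal (measure ?M (F q i -` A \<inter> SG q))) / 3"
      unfolding P_def by (subst nn_integral_pmf_of_set) auto
    also have "\<dots> = ennreal ((\<Sum>i\<in>UNIV. measure ?M (F q i -` A \<inter> SG q)) / 3)"
      by (simp add: sum_ennreal sum_nonneg flip: divide_ennreal)
    finally have "measure S (code -` A) = (\<Sum>i\<in>UNIV. measure ?M (F q i -` A \<inter> SG q)) / 3"
      by (simp add: sum_nonneg)
    then show ?thesis
      unfolding m[OF A'(1)] by (simp flip: sum_divide_distrib)
  qed
  moreover have "prob_space ?M"
    by (rule S.prob_space_distr[OF code])
  ultimately show ?thesis
    by (intro exI[of _ ?M]) auto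
qed

text \<open>A point of the gasket misses at least one of the three first-level cells. In the
  invariance identity at most two terms survive, each a third of the mass of at most one point, so n
  iterations bound the mass by (2/3)^n.\<close>

lemma self_similar_measure_singleton:
  assumes "prob_space M" and sets: "sets M = sets (restrict_space borel (SG q))"
    and self: "\<And>A. A \<in> sets M \<Longrightarrow> measure M A = (\<Sum>i\<in>UNIV. (1/3) * measure M (F q i -` A \<inter> SG q))"
    and "x \<in> SG q"
  shows "measure M {x} = 0"
proof -
  interpret prob_space M by fact
  have le: "measure M {x} \<le> (2/3) ^ n" if "x \<in> SG q" for x n
    using that
  proof (induction n arbitrary: x)
    case (Suc n)
    have pre: "measure M (F q i -` {x} \<inter> SG q) \<le> (2/3) ^ n" for i
    proof (cases "F q i -` {x} \<inter> SG q = {}")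
      case False
      then obtain y where "y \<in> SG q" "x = F q i y" by auto
      then have "F q i -` {x} \<inter> SG q = {y}" by auto
      with Suc.IH[OF \<open>y \<in> SG q\<close>] show ?thesis by simp
    qed simp
    \<comment> \<open>The three coordinates are nonnegative and sum to 1, so they cannot all be at
      least 1/2; on cell \<open>k\<close>, coordinate \<open>k\<close> is at least 1/2.\<close>
    obtain k where k: "bary k x < 1/2"
      using sum_bary[of x] bary_nonneg[OF Suc.prems] unfolding sum_3 by (smt (verit) field_sum_of_halves)
    have "F q k -` {x} \<inter> SG q = {}"
      using k bary_nonneg[of _ k] bary_F[of k k] by fastforce
    then have "(\<Sum>i\<in>UNIV. measure M (F q i -` {x} \<inter> SG q)) =
        (\<Sum>i\<in>UNIV - {k}. measure M (F q i -` {x} \<inter> SG q))"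
      by (intro sum.mono_neutral_right) auto
    also have "\<dots> \<le> (\<Sum>i\<in>UNIV - {k}. (2/3) ^ n)"
      by (intro sum_mono pre)
    also have "\<dots> = 2 * (2/3) ^ n"
      by (simp add: card_Diff_singleton)
    finally show ?case
      using self[of "{x}"] Suc.prems by (simp add: sets sets_restrict_SG flip: sum_divide_distrib)
  qed (simp add: prob_le_1)
  have "(\<lambda>n. (2/3 :: real) ^ n) \<longlonglongrightarrow> 0"
    by (rule LIMSEQ_power_zero) simp
  then have "measure M {x} \<le> 0"
    using le[OF \<open>x \<in> SG q\<close>] by (intro LIMSEQ_le_const) auto
  then show ?thesis
    using measure_nonneg[of M "{x}"] by linarith
qed

text \<open>For \<open>j \<noteq> i\<close> the preimage under \<open>F q j\<close> of a set in cell
  \<open>i\<close> is contained in \<open>{q i}\<close>, a null set. One term of the invariance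
  identity survives, and every letter contributes a factor 1/3.\<close>

lemma self_similar_measure_cell:
  assumes M: "prob_space M" and sets: "sets M = sets (restrict_space borel (SG q))"
    and self: "\<And>A. A \<in> sets M \<Longrightarrow> measure M A = (\<Sum>i\<in>UNIV. (1/3) * measure M (F q i -` A \<inter> SG q))"
  shows "measure M (F_word q w ` SG q) = (1/3) ^ length w"
proof (induction w)
  case Nil
  interpret prob_space M by fact
  have "space M = SG q"
    using sets_eq_imp_space_eq[OF sets] by (simp add: space_restrict_space)
  then show ?case using prob_space by simp
next
  case (Cons i w)
  interpret prob_space M by fact
  let ?A = "F_word q (i # w) ` SG q"
  have A: "?A \<in> sets M"
    using cell_measurable sets by blast
  have "measure M (F q j -` ?A \<inter> SG q) = 0" if "j \<noteq> i" for j
  proof -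
    have "F q j -` ?A \<inter> SG q \<subseteq> {q i}"
      using F_eq_F that F_word_in_SG by fastforce
    then have "F q j -` ?A \<inter> SG q = {} \<or> F q j -` ?A \<inter> SG q = {q i}"
      by blast
    then show ?thesis
      using self_similar_measure_singleton[OF M sets self q_in_SG] by auto
  qed
  then have "(\<Sum>j\<in>UNIV. measure M (F q j -` ?A \<inter> SG q)) = (\<Sum>j\<in>{i}. measure M (F q j -` ?A \<inter> SG q))"
    by (intro sum.mono_neutral_right) auto
  moreover have "F q i -` ?A \<inter> SG q = F_word q w ` SG q"
    using F_word_in_SG by auto
  ultimately show ?case
    using self[OF A] Cons.IH by (simp flip: sum_divide_distrib)
qed

lemma gasket_measure: "cell_measure (gasket_measure q)"
proof -
  let ?P = "\<lambda>M. prob_space M \<and> sets M = sets (restrict_space borel (SG q)) \<and>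
     (\<forall>A \<in> sets M. measure M A = (\<Sum>i\<in>UNIV. (1/3) * measure M (F q i -` A \<inter> SG q))) \<and>
     (\<forall>w. measure M (F_word q w ` SG q) = (1/3) ^ length w)"
  obtain M where M: "prob_space M" "sets M = sets (restrict_space borel (SG q))"
     "\<forall>A\<in>sets M. measure M A = (\<Sum>i\<in>UNIV. (1/3) * measure M (F q i -` A \<inter> SG q))"
    using self_similar_measure_exists by blast
  then have PM: "?P M"
    using self_similar_measure_cell[OF M(1,2)] by blast
  have "\<exists>!M. ?P M"
  proof (rule ex1I[of ?P, OF PM])
    fix N assume "?P N"
    then show "N = M"
      using PM by (intro cell_measure_unique) (auto simp: cell_measure_def)
  qed
  from theI'[OF this] show ?thesis
    unfolding gasket_measure_def[symmetric] cell_measure_def by blast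
qed

sublocale \<mu>: prob_space "gasket_measure q"
  using gasket_measure by (simp add: cell_measure_def)

lemma sets_gasket_measure: "sets (gasket_measure q) = sets (restrict_space borel (SG q))"
  using gasket_measure by (simp add: cell_measure_def)

lemma space_gasket_measure [simp]: "space (gasket_measure q) = SG q"
  using sets_eq_imp_space_eq[OF sets_gasket_measure] by (simp add: space_restrict_space)

end


section \<open>Energy and continuous extension\<close>

definition cell_form :: "(3 \<Rightarrow> real) \<Rightarrow> (3 \<Rightarrow> real) \<Rightarrow> real" where
  "cell_form a b = (\<Sum>i\<in>UNIV. \<Sum>j\<in>UNIV. (a i - a j) * (b i - b j)) / 2"

text \<open>Summation by parts on one triangle. The factor of \<open>b i\<close> is the graph
  Laplacian of \<open>a\<close>, the leading part of \<open>flux\<close> below.\<close>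

lemma cell_form_eq: "cell_form a b = - (\<Sum>i\<in>UNIV. ((\<Sum>j\<in>UNIV. a j) - 3 * a i) * b i)"
  by (simp add: cell_form_def sum_3 field_simps)

lemma cell_form_nonneg: "0 \<le> cell_form a a"
  by (auto simp: cell_form_def intro!: divide_nonneg_nonneg sum_nonneg)

text \<open>The refined energy is least when each midpoint value is
  \<open>((\<Sum>k\<in>UNIV. a k) + a i + a j) / 5\<close>, the average with weights 2/5, 2/5, 1/5,
  and that minimum is 3/5 of the old energy. With \<open>d\<close> the deviation from this optimum,
  the mixed terms cancel and the surplus is a sum of squares.\<close>

lemma cell_form_refine:
  assumes same: "\<And>i. b i i = a i" and swap: "\<And>i j. b i j = b j i"
  shows "cell_form a a \<le> 5 / 3 * (\<Sum>i\<in>UNIV. cell_form (b i) (b i))"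
proof -
  define d where "d i j = b i j - ((\<Sum>k\<in>UNIV. a k) + a i + a j) / 5" for i j
  have b: "b i j = d i j + ((\<Sum>k\<in>UNIV. a k) + a i + a j) / 5" for i j
    by (simp add: d_def)
  have "5 / 3 * (\<Sum>i\<in>UNIV. cell_form (b i) (b i)) - cell_form a a =
      5 / 3 * ((d 1 2 - d 1 3)\<^sup>2 + (d 1 2 - d 2 3)\<^sup>2 + (d 1 3 - d 2 3)\<^sup>2 +
        2 * ((d 1 2)\<^sup>2 + (d 1 3)\<^sup>2 + (d 2 3)\<^sup>2))"
    unfolding cell_form_def sum_3 same swap[of 2 1] swap[of 3 1] swap[of 3 2] b[of 1 2] b[of 1 3] b[of 2 3]
    by (simp add: power2_eq_square field_simps)
  also have "\<dots> \<ge> 0"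
    by (intro mult_nonneg_nonneg add_nonneg_nonneg) auto
  finally show ?thesis by simp
qed

context gasket
begin

section \<open>Graph energies and their limits\<close>

definition corner_vals :: "(real^2 \<Rightarrow> real) \<Rightarrow> 3 list \<Rightarrow> 3 \<Rightarrow> real" where
  "corner_vals u w = (\<lambda>i. u (corner q w i))"

definition graph_form :: "nat \<Rightarrow> (real^2 \<Rightarrow> real) \<Rightarrow> (real^2 \<Rightarrow> real) \<Rightarrow> real" where
  "graph_form n u v = (5/3) ^ n * (\<Sum>w\<in>words n. cell_form (corner_vals u w) (corner_vals v w))"

lemma cells_meet_once:
  assumes "length w = length w'" "w \<noteq> w'"
    "F_word q w x = F_word q w' y" "F_word q w x' = F_word q w' y'"
    "x \<in> SG q" "y \<in> SG q" "x' \<in> SG q" "y' \<in> SG q"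
  shows "x = x'"
  using assms(1-4)
proof (induction w w' rule: list_induct2)
  case (Cons a w b w')
  show ?case
  proof (cases "a = b")
    case False
    then have "F_word q w x = q b" "F_word q w x' = q b"
      using F_eq_F[of a "F_word q w x" b "F_word q w' y"] F_eq_F[of a "F_word q w x'" b "F_word q w' y'"]
        Cons.prems F_word_in_SG assms(5-) by simp_all
    then show ?thesis
      by (metis F_word_inject)
  qed (use Cons in auto)
qed simp

text \<open>Different cells of one level meet in at most one point, so two distinct corners
  determine their cell. This is what turns sums over edges into sums over cells.\<close>

lemma edge_word_unique:
  assumes "corner q w i = corner q w' i'" "corner q w j = corner q w' j'" "i \<noteq> j"
    "length w = length w'"
  shows "w = w' \<and> i = i' \<and> j = j'"
proof -
  have "w = w'"
    using cells_meet_once[OF assms(4) _ assms(1,2)[unfolded corner_def]] assms(3) by (auto simp: inj_q)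
  then show ?thesis
    using assms by simp
qed

lemma adjacent_iff:
  "adjacent q m x y \<longleftrightarrow> (\<exists>w\<in>words m. \<exists>i j. i \<noteq> j \<and> x = corner q w i \<and> y = corner q w j)"
proof -
  have "z \<in> F_word q w ` V q 0 \<longleftrightarrow> (\<exists>i. z = corner q w i)" for z w
    by (auto simp: corner_def)
  then show ?thesis
    unfolding adjacent_def words_def by auto
qed

lemma sum_adjacent:
  fixes g :: "real^2 \<Rightarrow> real^2 \<Rightarrow> real"
  assumes "\<And>x. g x x = 0"
  shows "(\<Sum>(x, y) \<in> {(x, y). adjacent q m x y}. g x y) =
    (\<Sum>w\<in>words m. \<Sum>i\<in>UNIV. \<Sum>j\<in>UNIV. g (corner q w i) (corner q w j))"
proof -
  let ?P = "words m \<times> {(i, j). (i :: 3) \<noteq> j}"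
  let ?h = "\<lambda>(w, i, j). (corner q w i, corner q w j)"
  have "inj_on ?h ?P"
  proof (rule inj_onI)
    fix s t assume st: "s \<in> ?P" "t \<in> ?P" "?h s = ?h t"
    obtain w i j w' i' j' where eq: "s = (w, i, j)" "t = (w', i', j')"
      by (metis prod.exhaust)
    have "w = w' \<and> i = i' \<and> j = j'"
      by (rule edge_word_unique) (use st in \<open>simp_all add: eq words_def\<close>)
    then show "s = t"
      by (simp add: eq)
  qed
  moreover have "?h ` ?P = {(x, y). adjacent q m x y}"
  proof (intro equalityI subsetI)
    fix z assume "z \<in> {(x, y). adjacent q m x y}"
    then obtain w i j where "w \<in> words m" "i \<noteq> j" "z = (corner q w i, corner q w j)"
      by (cases z) (auto simp: adjacent_iff)
    then show "z \<in> ?h ` ?P"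
      by (intro image_eqI[of _ _ "(w, i, j)"]) auto
  qed (auto simp: adjacent_iff simp del: corner_inject)
  ultimately have "(\<Sum>(x, y) \<in> {(x, y). adjacent q m x y}. g x y) = (\<Sum>(w, i, j)\<in>?P. g (corner q w i) (corner q w j))"
    by (intro sum.reindex_cong[of ?h]) auto
  also have "\<dots> = (\<Sum>(w, i, j)\<in>words m \<times> UNIV \<times> UNIV. g (corner q w i) (corner q w j))"
    by (intro sum.mono_neutral_left) (auto simp: assms)
  also have "\<dots> = (\<Sum>w\<in>words m. \<Sum>i\<in>UNIV. \<Sum>j\<in>UNIV. g (corner q w i) (corner q w j))"
    by (simp add: sum.cartesian_product)
  finally show ?thesis .
qed

lemma graph_energy_eq: "graph_energy q m u = graph_form m u u"
  unfolding graph_energy_def graph_form_def cell_form_def corner_vals_def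
  by (subst sum_adjacent) (auto simp: sum_divide_distrib power2_eq_square)

lemma graph_form_nonneg: "0 \<le> graph_form m u u"
  unfolding graph_form_def by (intro mult_nonneg_nonneg sum_nonneg cell_form_nonneg) auto

lemma graph_form_mono: "m \<le> n \<Longrightarrow> graph_form m u u \<le> graph_form n u u"
proof (induction rule: dec_induct)
  case (step n)
  have "(\<Sum>w\<in>words n. cell_form (corner_vals u w) (corner_vals u w)) \<le>
      (\<Sum>w\<in>words n. 5 / 3 * (\<Sum>i\<in>UNIV. cell_form (corner_vals u (w @ [i])) (corner_vals u (w @ [i]))))"
    by (intro sum_mono cell_form_refine) (auto simp: corner_vals_def corner_snoc_swap)
  then have "graph_form n u u \<le> graph_form (Suc n) u u"
    by (simp only: graph_form_def sum_words_snoc power_Suc2 mult.assoc sum_distrib_left[symmetric])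
       (intro mult_left_mono; simp)
  with step show ?case by simp
qed simp

lemma energy_eq_SUP: "energy q u = (SUP n. ereal (graph_form n u u))"
  unfolding energy_def graph_energy_eq
  by (intro limI LIMSEQ_SUP) (auto simp: incseq_def intro: graph_form_mono)

lemma dom_energy_iff:
  "u \<in> dom_energy q \<longleftrightarrow> continuous_on (SG q) u \<and> (\<exists>B. \<forall>n. graph_form n u u \<le> B)"
proof -
  have "energy q u < \<infinity> \<longleftrightarrow> (\<exists>B. \<forall>n. graph_form n u u \<le> B)"
  proof
    assume fin: "energy q u < \<infinity>"
    have "ereal (graph_form n u u) \<le> energy q u" for n
      unfolding energy_eq_SUP by (rule SUP_upper) simp
    moreover have "energy q u \<noteq> - \<infinity>"
      using calculation[of 0] by auto
    ultimately show "\<exists>B. \<forall>n. graph_form n u u \<le> B"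
      using fin by (cases "energy q u") auto
  next
    assume "\<exists>B. \<forall>n. graph_form n u u \<le> B"
    then obtain B where "\<And>n. graph_form n u u \<le> B" by blast
    then have "energy q u \<le> ereal B"
      unfolding energy_eq_SUP by (intro SUP_least) simp
    then show "energy q u < \<infinity>"
      using le_less_trans by fastforce
  qed
  then show ?thesis
    by (simp add: dom_energy_def)
qed

lemma dom_energy_continuous: "u \<in> dom_energy q \<Longrightarrow> continuous_on (SG q) u"
  by (simp add: dom_energy_iff)

lemma graph_form_tendsto_energy:
  assumes "\<And>n. graph_form n u u \<le> B"
  shows "(\<lambda>n. graph_form n u u) \<longlonglongrightarrow> real_of_ereal (energy q u)"
proof -
  obtain L where L: "(\<lambda>n. graph_form n u u) \<longlonglongrightarrow> L"
    using incseq_convergent[of "\<lambda>n. graph_form n u u" B] assms graph_form_mono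
    unfolding incseq_def by metis
  then have "energy q u = ereal L"
    unfolding energy_def graph_energy_eq by (intro limI) simp
  with L show ?thesis by simp
qed

lemma cell_form_polarization:
  "cell_form a b = (cell_form (\<lambda>i. a i + b i) (\<lambda>i. a i + b i) - cell_form (\<lambda>i. a i - b i) (\<lambda>i. a i - b i)) / 4"
  by (simp add: cell_form_def sum_3 field_simps)

lemma cell_form_parallelogram:
  "cell_form (\<lambda>i. a i + b i) (\<lambda>i. a i + b i) + cell_form (\<lambda>i. a i - b i) (\<lambda>i. a i - b i) =
    2 * cell_form a a + 2 * cell_form b b"
  by (simp add: cell_form_def sum_3 field_simps)

lemma graph_form_polarization:
  "graph_form n u v =
    (graph_form n (\<lambda>x. u x + v x) (\<lambda>x. u x + v x) - graph_form n (\<lambda>x. u x - v x) (\<lambda>x. u x - v x)) / 4"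
proof -
  have "(\<Sum>w\<in>words n. cell_form (corner_vals u w) (corner_vals v w)) =
    ((\<Sum>w\<in>words n. cell_form (corner_vals (\<lambda>x. u x + v x) w) (corner_vals (\<lambda>x. u x + v x) w)) -
      (\<Sum>w\<in>words n. cell_form (corner_vals (\<lambda>x. u x - v x) w) (corner_vals (\<lambda>x. u x - v x) w))) / 4"
    by (subst cell_form_polarization)
       (simp add: corner_vals_def sum_subtractf diff_divide_distrib sum_divide_distrib)
  from this show ?thesis
    by (simp only: graph_form_def times_divide_eq_right right_diff_distrib)
qed

lemma graph_form_parallelogram:
  "graph_form n (\<lambda>x. u x + v x) (\<lambda>x. u x + v x) + graph_form n (\<lambda>x. u x - v x) (\<lambda>x. u x - v x) =
    2 * graph_form n u u + 2 * graph_form n v v"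
proof -
  have "(\<Sum>w\<in>words n. cell_form (corner_vals (\<lambda>x. u x + v x) w) (corner_vals (\<lambda>x. u x + v x) w)) +
      (\<Sum>w\<in>words n. cell_form (corner_vals (\<lambda>x. u x - v x) w) (corner_vals (\<lambda>x. u x - v x) w)) =
    2 * (\<Sum>w\<in>words n. cell_form (corner_vals u w) (corner_vals u w)) + 2 * (\<Sum>w\<in>words n. cell_form (corner_vals v w) (corner_vals v w))"
    using cell_form_parallelogram[of "corner_vals u _" "corner_vals v _"]
    by (simp add: corner_vals_def sum_distrib_left flip: sum.distrib)
  then show ?thesis
    unfolding graph_form_def by (metis (no_types, lifting) distrib_left mult.left_commute)
qed

text \<open>The parallelogram identity bounds the graph energies of the sum and the difference. Both
  converge, and polarization passes to the limit.\<close>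

lemma energy_form_tendsto:
  assumes "u \<in> dom_energy q" "v \<in> dom_energy q"
  shows "(\<lambda>n. graph_form n u v) \<longlonglongrightarrow> energy_form q u v"
proof -
  obtain B C where B: "\<And>n. graph_form n u u \<le> B" and C: "\<And>n. graph_form n v v \<le> C"
    using assms by (auto simp: dom_energy_iff)
  have "graph_form n (\<lambda>x. u x + v x) (\<lambda>x. u x + v x) \<le> 2 * B + 2 * C"
    "graph_form n (\<lambda>x. u x - v x) (\<lambda>x. u x - v x) \<le> 2 * B + 2 * C" for n
    using graph_form_parallelogram[of n u v] B[of n] C[of n]
      graph_form_nonneg[of n "\<lambda>x. u x + v x"] graph_form_nonneg[of n "\<lambda>x. u x - v x"]
    by linarith+
  then show ?thesis
    unfolding graph_form_polarization[of _ u v] energy_form_def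
    by (intro tendsto_intros graph_form_tendsto_energy) auto
qed

section \<open>Continuous extension from the vertices\<close>

lemma cell_subset_closure: "F_word q w ` SG q \<subseteq> closure (\<Union>v. range (corner q (w @ v)))"
proof -
  have "F_word q w ` (\<Union>m. V q m) \<subseteq> (\<Union>v. range (corner q (w @ v)))"
    by (auto simp: V_eq_corner corner_def F_word_append)
  then show ?thesis
    unfolding SG_eq_closure
    by (intro image_closure_subset continuous_on_F_word order_trans[OF _ closure_subset]) simp_all
qed

text \<open>One level has finitely many pairs of cells, and disjoint compact sets have positive
  distance. The use is the contrapositive: points closer than \<open>d\<close> lie in cells that
  meet.\<close>

lemma disjoint_cells_separated:
  obtains d where "d > 0" "\<And>w w' x y. \<lbrakk>w \<in> words n; w' \<in> words n;
    F_word q w ` SG q \<inter> F_word q w' ` SG q = {}; x \<in> F_word q w ` SG q; y \<in> F_word q w' ` SG q\<rbrakk>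
    \<Longrightarrow> d \<le> dist x y"
proof -
  let ?S = "{(w, w')\<in>words n \<times> words n. F_word q w ` SG q \<inter> F_word q w' ` SG q = {}}"
  have "\<forall>p\<in>?S. \<exists>d>0. \<forall>x\<in>F_word q (fst p) ` SG q. \<forall>y\<in>F_word q (snd p) ` SG q. d \<le> dist x y"
  proof
    fix p assume "p \<in> ?S"
    then show "\<exists>d>0. \<forall>x\<in>F_word q (fst p) ` SG q. \<forall>y\<in>F_word q (snd p) ` SG q. d \<le> dist x y"
      by (intro separate_compact_closed compact_cell compact_imp_closed) auto
  qed
  from bchoice[OF this] obtain d where d: "\<forall>p\<in>?S. d p > 0 \<and>
    (\<forall>x\<in>F_word q (fst p) ` SG q. \<forall>y\<in>F_word q (snd p) ` SG q. d p \<le> dist x y)" ..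
  \<comment> \<open>The extra 1 keeps the minimum meaningful when no two cells of the level are
    disjoint.\<close>
  define D where "D = Min (insert 1 (d ` ?S))"
  have fin: "finite ?S"
    by (rule finite_subset[of _ "words n \<times> words n"]) auto
  have pos: "D > 0"
    unfolding D_def using fin d by (subst Min_gr_iff) auto
  have D: "D \<le> d p" if "p \<in> ?S" for p
    unfolding D_def using fin that by (intro Min_le) auto
  have sep: "D \<le> dist x y" if "w \<in> words n" "w' \<in> words n" "F_word q w ` SG q \<inter> F_word q w' ` SG q = {}"
    "x \<in> F_word q w ` SG q" "y \<in> F_word q w' ` SG q" for w w' x y
  proof -
    have S: "(w, w') \<in> ?S"
      using that by simp
    have "d (w, w') \<le> dist x y"
      using bspec[OF d S] that(4,5) by (simp only: fst_conv snd_conv)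
    with D[OF S] show ?thesis
      by linarith
  qed
  show ?thesis
    by (rule that[OF pos sep])
qed

text \<open>A function on the vertices is given by its values \<open>c w i\<close> at the corners of all cells. It
  extends continuously to the gasket as soon as its oscillation over the cells decays.\<close>

lemma continuous_extension_exists:
  fixes c :: "3 list \<Rightarrow> 3 \<Rightarrow> real"
  assumes same: "\<And>w i. c (w @ [i]) i = c w i"
    and swap: "\<And>w i j. c (w @ [i]) j = c (w @ [j]) i"
    and jump: "\<And>w i j. \<bar>c w i - c w j\<bar> \<le> C * r ^ length w"
    and r: "0 \<le> r" "r < 1"
  shows "\<exists>U. continuous_on (SG q) U \<and> (\<forall>w i. U (corner q w i) = c w i)"
proof -
  have rep: "c (w @ replicate k i) i = c w i" for w k i
  proof (induction k)
    case (Suc k)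
    then show ?case
      using same[of "w @ replicate k i" i] by (simp add: replicate_append_same)
  qed simp
  have wd: "c w i = c w' j" if eq: "corner q w i = corner q w' j" and le: "length w \<le> length w'" for w w' i j
  proof -
    \<comment> \<open>Appending copies of \<open>i\<close> shrinks the cell but fixes its corner
      \<open>i\<close>, so the two addresses may be compared at equal length.\<close>
    define v where "v = w @ replicate (length w' - length w) i"
    have "corner q v i = corner q w' j" "length v = length w'"
      using eq le by (simp_all add: v_def)
    from corner_eq_corner[OF this]
    have "v = w' \<and> i = j \<or>
      (\<exists>t k. i \<noteq> j \<and> v = t @ j # replicate k i \<and> w' = t @ i # replicate k j)" .
    then have "c v i = c w' j"
      using rep[of "_ @ [_]"] swap by auto
    then show ?thesis
      by (simp add: v_def rep)
  qed
  have wd: "c w i = c w' j" if "corner q w i = corner q w' j" for w w' i j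
    using wd[of w i w' j] wd[of w' j w i] that by (cases "length w \<le> length w'") auto
  define f where "f x = c (fst (SOME (w, i). corner q w i = x)) (snd (SOME (w, i). corner q w i = x))" for x
  have f: "f (corner q w i) = c w i" for w i
  proof -
    let ?s = "SOME (w', i'). corner q w' i' = corner q w i"
    have "(\<lambda>(w', i'). corner q w' i' = corner q w i) ?s"
      by (rule someI[of _ "(w, i)"]) simp
    then show ?thesis
      unfolding f_def using wd[of "fst ?s" "snd ?s" w i] by (simp add: case_prod_beta)
  qed
  have C: "0 \<le> C"
    using jump[of "[]" 1 2] by simp
  \<comment> \<open>The geometric series of all later jumps; the induction over \<open>v\<close>
    uses it through \<open>C + K * r = K\<close>.\<close>
  define K where "K = C / (1 - r)"
  have K: "0 \<le> K" "C + K * r = K"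
    using C r by (simp_all add: K_def field_simps)
  have osc: "\<bar>c (w @ v) i - c w j\<bar> \<le> K * r ^ length w" for w v i j
  proof (induction v arbitrary: w j)
    case Nil
    have "C \<le> K"
      using K r mult_nonneg_nonneg[of K r] by linarith
    then have "C * r ^ length w \<le> K * r ^ length w"
      using r by (intro mult_right_mono) auto
    then show ?case
      using jump[of w i j] by simp
  next
    case (Cons a v)
    have "\<bar>c (w @ a # v) i - c (w @ [a]) a\<bar> \<le> K * r ^ Suc (length w)"
      using Cons[of "w @ [a]" a] by simp
    moreover have "\<bar>c (w @ [a]) a - c w j\<bar> \<le> C * r ^ length w"
      using jump[of w a j] by (simp add: same)
    ultimately have "\<bar>c (w @ a # v) i - c w j\<bar> \<le> K * r ^ Suc (length w) + C * r ^ length w"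
      by linarith
    also have "\<dots> = (C + K * r) * r ^ length w"
      by (simp add: algebra_simps)
    finally show ?case by (simp add: K)
  qed
  let ?V = "\<Union>m. V q m"
  have "uniformly_continuous_on ?V f"
    unfolding uniformly_continuous_on_def dist_real_def
  proof (intro allI impI)
    fix e :: real assume e: "e > 0"
    have "(\<lambda>n. 2 * K * r ^ n) \<longlonglongrightarrow> 2 * K * 0"
      using r by (intro tendsto_intros LIMSEQ_realpow_zero) auto
    then have "\<forall>\<^sub>F n in sequentially. 2 * K * r ^ n < e"
      using e by (intro order_tendstoD) auto
    then obtain n where n: "2 * K * r ^ n < e"
      by (auto simp: eventually_sequentially)
    obtain d where d: "d > 0" "\<And>w w' x y. \<lbrakk>w \<in> words n; w' \<in> words n;
        F_word q w ` SG q \<inter> F_word q w' ` SG q = {}; x \<in> F_word q w ` SG q; y \<in> F_word q w' ` SG q\<rbrakk>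
        \<Longrightarrow> d \<le> dist x y"
      by (fact disjoint_cells_separated)
    have word: "\<exists>w v i. w \<in> words n \<and> x = corner q (w @ v) i" if "x \<in> ?V" for x
    proof -
      obtain t i where "x = corner q t i"
        using \<open>x \<in> ?V\<close> by (auto simp: V_eq_corner)
      then have "x = corner q (take n (t @ replicate n i) @ drop n (t @ replicate n i)) i"
        by (simp only: append_take_drop_id corner_replicate)
      then show ?thesis
        by (intro exI[of _ "take n (t @ replicate n i)"] exI[of _ "drop n (t @ replicate n i)"] exI[of _ i] conjI)
           (simp_all add: words_def)
    qed
    have "\<bar>f y - f x\<bar> < e" if xy: "x \<in> ?V" "y \<in> ?V" "dist y x < d" for x y
    proof -
      obtain w v i w' v' i' where w: "w \<in> words n" "x = corner q (w @ v) i"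
        and w': "w' \<in> words n" "y = corner q (w' @ v') i'"
        using word xy(1,2) by meson
      have in_cell: "x \<in> F_word q w ` SG q" "y \<in> F_word q w' ` SG q"
        using w w' corner_in_SG by (auto simp: corner_def F_word_append)
      then have "F_word q w ` SG q \<inter> F_word q w' ` SG q \<noteq> {}"
        using d(2)[OF w'(1) w(1) _ in_cell(2,1)] xy(3) by fastforce
      then obtain x' y' where meet: "F_word q w x' = F_word q w' y'" "x' \<in> SG q" "y' \<in> SG q"
        by auto
      \<comment> \<open>Meeting cells share a corner, and both function values lie within
        \<open>K * r ^ n\<close> of the common value there.\<close>
      have "\<exists>j j'. corner q w j = corner q w' j'"
      proof (cases "w = w'")
        case False
        show ?thesis
          by (rule F_word_eq_F_word[OF meet(1) _ False meet(2,3)])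
             (use w w' meet(1) in \<open>auto simp: words_def corner_def\<close>)
      qed auto
      then obtain j j' where "c w j = c w' j'"
        using wd by blast
      moreover have "\<bar>f x - c w j\<bar> \<le> K * r ^ n" "\<bar>f y - c w' j'\<bar> \<le> K * r ^ n"
        using osc[of w v i j] osc[of w' v' i' j'] w w' by (simp_all add: f words_def)
      ultimately show ?thesis
        using n by linarith
    qed
    then show "\<exists>d>0. \<forall>x\<in>?V. \<forall>y\<in>?V. dist y x < d \<longrightarrow> \<bar>f y - f x\<bar> < e"
      using d(1) by blast
  qed
  from uniformly_continuous_on_extension_on_closure[OF this]
  obtain U where U: "uniformly_continuous_on (SG q) U" "\<And>x. x \<in> ?V \<Longrightarrow> f x = U x"
    unfolding SG_eq_closure by metis
  have "U (corner q w i) = c w i" for w i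
  proof -
    have "corner q w i \<in> ?V"
      using corner_in_V by blast
    from U(2)[OF this] show ?thesis
      by (simp add: f)
  qed
  then show ?thesis
    using U(1) uniformly_continuous_imp_continuous by blast
qed

end


section \<open>Biharmonic splines\<close>

text \<open>The harmonic extension rule with weights 2/5, 2/5, 1/5, which is the optimum found in
  \<open>cell_form_refine\<close>; \<open>i\<close> names the subcell.\<close>

definition harmonic_step :: "3 \<Rightarrow> (3 \<Rightarrow> real) \<Rightarrow> 3 \<Rightarrow> real" where
  "harmonic_step i a j = (if j = i then a i else ((\<Sum>k\<in>UNIV. a k) + a i + a j) / 5)"

text \<open>The corner values \<open>a\<close> of a function with harmonic Laplacian, together with the numbers
  \<open>r j = 5 ^ (- k) * p j\<close> for the corner values \<open>p\<close> of its Laplacian on a cell of level \<open>k\<close>,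
  determine the corresponding data on the subcells.\<close>

definition biharmonic_step :: "3 \<Rightarrow> (3 \<Rightarrow> real) \<times> (3 \<Rightarrow> real) \<Rightarrow> (3 \<Rightarrow> real) \<times> (3 \<Rightarrow> real)" where
  "biharmonic_step i = (\<lambda>(a, r).
     (\<lambda>j. harmonic_step i a j - (if j = i then 0 else (7 * (\<Sum>k\<in>UNIV. r k) + 2 * r i + 2 * r j) / 375),
      \<lambda>j. harmonic_step i r j / 5))"

text \<open>The outward normal derivative at a corner, up to the factor \<open>- (5/3) ^ k\<close> on level \<open>k\<close>.\<close>

definition flux :: "(3 \<Rightarrow> real) \<times> (3 \<Rightarrow> real) \<Rightarrow> 3 \<Rightarrow> real" where
  "flux = (\<lambda>(a, r) i. (\<Sum>k\<in>UNIV. a k) - 3 * a i - (3 * r i + 4 * (\<Sum>k\<in>UNIV. r k)) / 45)"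

lemma third_index:
  fixes i j :: 3
  assumes "i \<noteq> j"
  obtains k where "k \<noteq> i" "k \<noteq> j" "\<And>f :: 3 \<Rightarrow> real. sum f UNIV = f i + f j + f k"
proof -
  have "card (UNIV - {i, j}) = 1"
    using assms by (simp add: card_Diff_subset)
  then obtain k where k: "UNIV - {i, j} = {k}"
    by (auto simp: card_1_singleton_iff)
  then have ne: "k \<noteq> i" "k \<noteq> j"
    by auto
  from k have U: "UNIV = {i, j, k}"
    by auto
  have "sum f UNIV = f i + f j + f k" for f :: "3 \<Rightarrow> real"
    unfolding U using ne[symmetric] assms by (simp add: add.assoc)
  with ne show ?thesis
    by (rule that)
qed

text \<open>The factor 3/5 is undone by the energy renormalization. The harmonic rule gives it for
  the values \<open>a\<close>; over the denominator 1125, the midpoint correction and the refined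
  source together give 48 + 12 = 60 for the sum of \<open>r\<close> and 6 + 39 = 45 for
  \<open>r i\<close>, which is 3/5 of the old source term.\<close>

lemma flux_step_same: "flux (biharmonic_step i s) i = 3 / 5 * flux s i"
proof -
  obtain a r where s: "s = (a, r)"
    by force
  obtain k where k: "k \<noteq> i" "k \<noteq> i + 1" "\<And>f :: 3 \<Rightarrow> real. sum f UNIV = f i + f (i + 1) + f k"
    using third_index[of i "i + 1"] by (metis add_cancel_left_right zero_neq_one)
  show ?thesis
    unfolding s flux_def biharmonic_step_def harmonic_step_def k(3) case_prod_conv
    by (simp add: k(1,2) field_simps)
qed

text \<open>No flux arises at a new midpoint. These three balance equations are linear in the three
  midpoint corrections, with matrix 5 I - J where J has all entries 1; their unique solution is the
  term with denominator 375 in \<open>biharmonic_step\<close>.\<close>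

lemma flux_step_swap:
  assumes "i \<noteq> j"
  shows "flux (biharmonic_step i s) j + flux (biharmonic_step j s) i = 0"
proof -
  obtain a r where s: "s = (a, r)"
    by force
  obtain k where k: "k \<noteq> i" "k \<noteq> j" "\<And>f :: 3 \<Rightarrow> real. sum f UNIV = f i + f j + f k"
    using third_index[OF assms] by metis
  show ?thesis
    unfolding s flux_def biharmonic_step_def harmonic_step_def k(3) case_prod_conv
    by (simp add: k(1,2) assms assms[symmetric] field_simps)
qed

lemma sum_flux_step:
  assumes "\<And>i j. b i j = b j i"
  shows "(\<Sum>i\<in>UNIV. \<Sum>j\<in>UNIV. flux (biharmonic_step i s) j * b i j) =
    3 / 5 * (\<Sum>i\<in>UNIV. flux s i * b i i)"
proof -
  let ?f = "\<lambda>i j. flux (biharmonic_step i s) j"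
  have "?f 1 2 * b 1 2 + ?f 2 1 * b 1 2 = 0" "?f 1 3 * b 1 3 + ?f 3 1 * b 1 3 = 0"
    "?f 2 3 * b 2 3 + ?f 3 2 * b 2 3 = 0"
    using flux_step_swap[of 1 2 s] flux_step_swap[of 1 3 s] flux_step_swap[of 2 3 s]
    by (simp_all flip: distrib_right)
  then show ?thesis
    unfolding sum_3 assms[of 2 1] assms[of 3 1] assms[of 3 2]
    by (simp add: flux_step_same algebra_simps)
qed

text \<open>A maximum principle: every new value is an average of old ones.\<close>

lemma harmonic_step_near:
  assumes "\<And>j. \<bar>a j - c\<bar> \<le> e"
  shows "\<bar>harmonic_step i a j - c\<bar> \<le> e"
proof -
  have "\<bar>a i - c\<bar> \<le> e" "\<bar>a j - c\<bar> \<le> e" "\<bar>a 1 - c\<bar> \<le> e" "\<bar>a 2 - c\<bar> \<le> e" "\<bar>a 3 - c\<bar> \<le> e"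
    using assms by auto
  then show ?thesis
    unfolding harmonic_step_def sum_3 abs_le_iff by (cases "j = i") (simp, simp add: field_simps)
qed

text \<open>One number \<open>K\<close> controls both the differences of the values and the scaled
  source. The averages contribute at most 4/5 of it and the correction (3 * 7 + 4) / 375 = 1/15,
  together less than 9/10. A factor below 1 is what the continuous extension requires.\<close>

lemma biharmonic_step_bounds:
  assumes "\<And>i j. \<bar>fst s i - fst s j\<bar> \<le> K" "\<And>i. \<bar>snd s i\<bar> \<le> K"
  shows "\<bar>fst (biharmonic_step i s) j - fst (biharmonic_step i s) k\<bar> \<le> 9/10 * K"
    and "\<bar>snd (biharmonic_step i s) j\<bar> \<le> 9/10 * K"
proof -
  obtain a r where s: "s = (a, r)"
    by force
  have a: "a i - a j \<le> K" for i j
    using assms(1)[of i j] by (simp add: s)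
  have r: "r i \<le> K" "- r i \<le> K" for i
    using assms(2)[of i] by (simp_all add: s)
  let ?b = "fst (biharmonic_step i s)"
  have b: "?b j = (if j = i then a i
      else (a 1 + a 2 + a 3 + a i + a j) / 5 - (7 * (r 1 + r 2 + r 3) + 2 * r i + 2 * r j) / 375)" for j
    by (simp add: s biharmonic_step_def harmonic_step_def sum_3)
  have K: "0 \<le> K"
    using a[of 1 1] by simp
  have ij: "a i - ?b j \<le> 9/10 * K" "?b j - a i \<le> 9/10 * K" if "j \<noteq> i" for j
  proof -
    have "?b j = (a 1 + a 2 + a 3 + a i + a j) / 5 - (7 * (r 1 + r 2 + r 3) + 2 * r i + 2 * r j) / 375"
      using that by (simp add: b)
    note eq = this
    show "a i - ?b j \<le> 9/10 * K"
      using eq K a[of i 1] a[of i 2] a[of i 3] a[of i j] r(1)[of 1] r(1)[of 2] r(1)[of 3] r(1)[of i] r(1)[of j]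
      by (simp add: field_simps)
    show "?b j - a i \<le> 9/10 * K"
      using eq K a[of 1 i] a[of 2 i] a[of 3 i] a[of j i] r(2)[of 1] r(2)[of 2] r(2)[of 3] r(2)[of i] r(2)[of j]
      by (simp add: field_simps)
  qed
  have jk: "?b j - ?b k \<le> 9/10 * K" if "j \<noteq> i" "k \<noteq> i" for j k
  proof -
    have "?b j - ?b k = (a j - a k) / 5 + (2 * r k - 2 * r j) / 375"
      using that by (simp add: b field_simps)
    then show ?thesis
      using a[of j k] r(1)[of k] r(2)[of j] K by (simp add: field_simps)
  qed
  have le: "?b j - ?b k \<le> 9/10 * K" for j k
    using ij jk K b[of i] by (cases "j = i"; cases "k = i") simp_all
  show "\<bar>?b j - ?b k\<bar> \<le> 9/10 * K"
    using le[of j k] le[of k j] by linarith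
  have "\<bar>harmonic_step i r j - 0\<bar> \<le> K"
    by (rule harmonic_step_near) (use assms(2) s in auto)
  then show "\<bar>snd (biharmonic_step i s) j\<bar> \<le> 9/10 * K"
    unfolding s biharmonic_step_def by simp
qed

context gasket
begin

text \<open>Down to level \<open>m\<close> the state is read off from \<open>g\<close> and
  \<open>p\<close>; only the letters beyond level \<open>m\<close> are folded with the refinement
  rule. Short words are covered as well because the extension theorem asks for values on all
  cells.\<close>

definition spline_state ::
  "nat \<Rightarrow> (real^2 \<Rightarrow> real) \<Rightarrow> (real^2 \<Rightarrow> real) \<Rightarrow> 3 list \<Rightarrow> (3 \<Rightarrow> real) \<times> (3 \<Rightarrow> real)" where
  "spline_state m g p w = foldl (\<lambda>s i. biharmonic_step i s)
     (corner_vals g (take m w), \<lambda>i. corner_vals p (take m w) i / 5 ^ length (take m w)) (drop m w)"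

lemma spline_state_coarse:
  "length w \<le> m \<Longrightarrow> spline_state m g p w = (corner_vals g w, \<lambda>i. corner_vals p w i / 5 ^ length w)"
  by (simp add: spline_state_def)

lemma spline_state_snoc:
  "m \<le> length w \<Longrightarrow> spline_state m g p (w @ [i]) = biharmonic_step i (spline_state m g p w)"
  by (simp add: spline_state_def)

lemma snd_spline_state_0: "snd (spline_state m p (\<lambda>_. 0) w) = (\<lambda>_. 0)"
proof (induction w rule: rev_induct)
  case (snoc i w)
  then show ?case
    by (cases "length w < m")
       (auto simp: spline_state_coarse spline_state_snoc corner_vals_def biharmonic_step_def
         harmonic_step_def case_prod_beta)
qed (simp add: spline_state_def corner_vals_def)

text \<open>The source refines by the harmonic rule alone, so up to the scale it is the value part
  of a spline without source. Hence \<open>spline m p (\<lambda>_. 0)\<close> can serve as the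
  Laplacian of \<open>spline m g p\<close>.\<close>

lemma snd_spline_state:
  "snd (spline_state m g p w) = (\<lambda>i. fst (spline_state m p (\<lambda>_. 0) w) i / 5 ^ length w)"
proof (induction w rule: rev_induct)
  case (snoc i w)
  show ?case
  proof (cases "length w < m")
    case False
    then show ?thesis
      using snoc snd_spline_state_0[of m p w]
      by (auto simp: spline_state_snoc biharmonic_step_def harmonic_step_def case_prod_beta
          sum_3 fun_eq_iff add_divide_distrib)
  qed (simp add: spline_state_coarse)
qed (simp add: spline_state_def)

lemma spline_exists:
  "\<exists>U. continuous_on (SG q) U \<and> (\<forall>w. corner_vals U w = fst (spline_state m g p w))"
proof -
  let ?s = "spline_state m g p"
  obtain B where B: "\<And>x. x \<in> V q m \<Longrightarrow> \<bar>g x\<bar> \<le> B" "\<And>x. x \<in> V q m \<Longrightarrow> \<bar>p x\<bar> \<le> B"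
  proof (rule that[of "Max ((\<lambda>x. max \<bar>g x\<bar> \<bar>p x\<bar>) ` V q m)"])
    fix x assume "x \<in> V q m"
    then have "max \<bar>g x\<bar> \<bar>p x\<bar> \<le> Max ((\<lambda>x. max \<bar>g x\<bar> \<bar>p x\<bar>) ` V q m)"
      by (intro Max_ge) auto
    then show "\<bar>g x\<bar> \<le> Max ((\<lambda>x. max \<bar>g x\<bar> \<bar>p x\<bar>) ` V q m)"
      "\<bar>p x\<bar> \<le> Max ((\<lambda>x. max \<bar>g x\<bar> \<bar>p x\<bar>) ` V q m)"
      by auto
  qed
  have B0: "0 \<le> B"
  proof -
    have "q 1 \<in> V q m"
      using V_mono[of 0 m q] by auto
    from B(1)[OF this] show ?thesis by linarith
  qed
  \<comment> \<open>There is no contraction down to level \<open>m\<close>, so \<open>C\<close> is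
    enlarged until \<open>C * (9/10) ^ k\<close> still exceeds the trivial bound
    \<open>2 * B\<close> for every \<open>k \<le> m\<close>.\<close>
  define C where "C = 2 * B / (9/10) ^ m"
  have bounds: "(\<forall>i j. \<bar>fst (?s w) i - fst (?s w) j\<bar> \<le> C * (9/10) ^ length w) \<and>
      (\<forall>i. \<bar>snd (?s w) i\<bar> \<le> C * (9/10) ^ length w)" for w
  proof (induction w rule: rev_induct)
    case (snoc i w)
    show ?case
    proof (cases "length w < m")
      case False
      then show ?thesis
        using snoc biharmonic_step_bounds[of "?s w" "C * (9/10) ^ length w" i]
        by (simp add: spline_state_snoc mult.left_commute)
    next
      case True
      define w' where "w' = w @ [i]"
      have len: "length w' \<le> m"
        using True by (simp add: w'_def)
      have "(9/10 :: real) ^ m \<le> (9/10) ^ length w'"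
        using len by (intro power_decreasing) auto
      then have "2 * B * 1 \<le> 2 * B * ((9/10) ^ length w' / (9/10) ^ m)"
        using B0 by (intro mult_left_mono) auto
      then have C: "2 * B \<le> C * (9/10) ^ length w'"
        by (simp add: C_def)
      have V: "corner q w' j \<in> V q m" for j
        using corner_in_V V_mono[OF len] by blast
      have "\<bar>g (corner q w' j) - g (corner q w' k)\<bar> \<le> 2 * B" for j k
        using B(1)[OF V[of j]] B(1)[OF V[of k]] by linarith
      moreover have "\<bar>p (corner q w' j) / 5 ^ length w'\<bar> \<le> 2 * B" for j
      proof -
        have "\<bar>p (corner q w' j) / 5 ^ length w'\<bar> \<le> \<bar>p (corner q w' j)\<bar> / 1"
          unfolding abs_divide by (intro divide_left_mono) auto
        then show ?thesis
          using B(2)[OF V[of j]] B0 by linarith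
      qed
      ultimately show ?thesis
        unfolding w'_def[symmetric] spline_state_coarse[OF len] corner_vals_def fst_conv snd_conv
        using C order_trans by blast
    qed
  next
    case Nil
    have V: "q j \<in> V q m" for j
      using V_mono[of 0 m q] by auto
    have "(9/10 :: real) ^ m \<le> 1"
      by (intro power_le_one) auto
    then have "2 * B * 1 \<le> 2 * B * (1 / (9/10) ^ m)"
      using B0 by (intro mult_left_mono) auto
    then have C: "2 * B \<le> C"
      by (simp add: C_def)
    have "\<bar>g (q j) - g (q k)\<bar> \<le> C" for j k
      using B(1)[OF V[of j]] B(1)[OF V[of k]] C by linarith
    moreover have "\<bar>p (q j)\<bar> \<le> C" for j
      using B(2)[OF V[of j]] B0 C by linarith
    ultimately show ?case
      by (simp add: spline_state_def corner_vals_def)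
  qed
  have "\<exists>U. continuous_on (SG q) U \<and> (\<forall>w i. U (corner q w i) = fst (?s w) i)"
  proof (rule continuous_extension_exists)
    show "fst (?s (w @ [i])) i = fst (?s w) i" for w i
      by (cases "length w < m")
         (auto simp: spline_state_coarse spline_state_snoc corner_vals_def biharmonic_step_def
           harmonic_step_def case_prod_beta)
    show "fst (?s (w @ [i])) j = fst (?s (w @ [j])) i" for w i j
      by (cases "length w < m")
         (auto simp: spline_state_coarse spline_state_snoc corner_vals_def biharmonic_step_def
           harmonic_step_def case_prod_beta corner_snoc_swap[of q w i j] add_ac)
    show "\<bar>fst (?s w) i - fst (?s w) j\<bar> \<le> C * (9/10) ^ length w" for w i j
      using bounds by blast
  qed auto
  then show ?thesis
    by (auto simp: corner_vals_def fun_eq_iff)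
qed

text \<open>For unrelated \<open>g\<close> and \<open>p\<close> the normal derivatives may fail to
  cancel at the vertices of level \<open>m\<close>; \<open>flux_form\<close> records this
  defect.\<close>

definition spline :: "nat \<Rightarrow> (real^2 \<Rightarrow> real) \<Rightarrow> (real^2 \<Rightarrow> real) \<Rightarrow> real^2 \<Rightarrow> real" where
  "spline m g p = (SOME U. continuous_on (SG q) U \<and> (\<forall>w. corner_vals U w = fst (spline_state m g p w)))"

lemma continuous_spline: "continuous_on (SG q) (spline m g p)"
  and corner_vals_spline: "corner_vals (spline m g p) w = fst (spline_state m g p w)"
  using someI_ex[OF spline_exists[of m g p]] by (auto simp: spline_def)

lemma spline_on_V:
  assumes "x \<in> V q m"
  shows "spline m g p x = g x"
proof -
  obtain w i where "w \<in> words m" "x = corner q w i"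
    using assms by (auto simp: V_eq_corner)
  then show ?thesis
    using fun_cong[OF corner_vals_spline[of m g p w], of i]
    by (simp add: spline_state_coarse words_def corner_vals_def)
qed

lemma spline_state_eq:
  "spline_state m g p w =
    (corner_vals (spline m g p) w, \<lambda>i. corner_vals (spline m p (\<lambda>_. 0)) w i / 5 ^ length w)"
  by (simp add: corner_vals_spline prod_eq_iff snd_spline_state)

text \<open>The boundary term of the Gauss--Green formula over the cells of level \<open>n\<close>.\<close>

definition flux_form :: "nat \<Rightarrow> (3 list \<Rightarrow> (3 \<Rightarrow> real) \<times> (3 \<Rightarrow> real)) \<Rightarrow> (real^2 \<Rightarrow> real) \<Rightarrow> real" where
  "flux_form n s v = (5/3) ^ n * (\<Sum>w\<in>words n. \<Sum>i\<in>UNIV. flux (s w) i * v (corner q w i))"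

text \<open>Passing to the next level cancels the contributions at new midpoints and multiplies
  those at old corners by 3/5, which the prefactor compensates.\<close>

lemma flux_form_spline:
  "m \<le> n \<Longrightarrow> flux_form n (spline_state m g p) v = flux_form m (spline_state m g p) v"
proof (induction rule: dec_induct)
  case (step n)
  have "(\<Sum>w\<in>words n. \<Sum>i\<in>UNIV. \<Sum>j\<in>UNIV. flux (spline_state m g p (w @ [i])) j * v (corner q (w @ [i]) j)) =
      (\<Sum>w\<in>words n. 3 / 5 * (\<Sum>i\<in>UNIV. flux (spline_state m g p w) i * v (corner q w i)))"
  proof (rule sum.cong[OF refl])
    fix w assume "w \<in> words n"
    then have len: "m \<le> length w"
      using step by (simp add: words_def)
    show "(\<Sum>i\<in>UNIV. \<Sum>j\<in>UNIV. flux (spline_state m g p (w @ [i])) j * v (corner q (w @ [i]) j)) =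
        3 / 5 * (\<Sum>i\<in>UNIV. flux (spline_state m g p w) i * v (corner q w i))"
      using sum_flux_step[of "\<lambda>i j. v (corner q (w @ [i]) j)" "spline_state m g p w"]
      by (simp add: spline_state_snoc[OF len] corner_snoc_swap)
  qed
  then have "flux_form (Suc n) (spline_state m g p) v = flux_form n (spline_state m g p) v"
    by (simp only: flux_form_def sum_words_snoc sum_distrib_left[symmetric] power_Suc2 mult.assoc)
  with step show ?case by simp
qed simp

text \<open>An exact Gauss-Green formula at finite level: by the definition of \<open>flux\<close>,
  the graph Laplacian on a cell is flux plus source. The source carries 5^(-n), and (5/3)^n / 5^n =
  1/3^n is the mass of a cell, so the last term is a Riemann sum.\<close>

lemma graph_form_spline:
  assumes "m \<le> n"
  shows "graph_form n (spline m g p) v = - flux_form m (spline_state m g p) v -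
    (\<Sum>w\<in>words n. \<Sum>i\<in>UNIV. (3 * spline m p (\<lambda>_. 0) (corner q w i) +
       4 * (\<Sum>j\<in>UNIV. spline m p (\<lambda>_. 0) (corner q w j))) * v (corner q w i)) / (45 * 3 ^ n)"
proof -
  let ?P = "\<lambda>w i. 3 * spline m p (\<lambda>_. 0) (corner q w i) + 4 * (\<Sum>j\<in>UNIV. spline m p (\<lambda>_. 0) (corner q w j))"
  have "cell_form (corner_vals (spline m g p) w) (corner_vals v w) =
      - (\<Sum>i\<in>UNIV. flux (spline_state m g p w) i * v (corner q w i)) -
        (\<Sum>i\<in>UNIV. ?P w i * v (corner q w i)) / (45 * 5 ^ n)" if "w \<in> words n" for w
    using that unfolding cell_form_eq spline_state_eq flux_def corner_vals_def words_def sum_3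
    by (simp add: field_simps)
  then have "graph_form n (spline m g p) v =
      (5/3) ^ n * ((\<Sum>w\<in>words n. - (\<Sum>i\<in>UNIV. flux (spline_state m g p w) i * v (corner q w i))) -
        (\<Sum>w\<in>words n. (\<Sum>i\<in>UNIV. ?P w i * v (corner q w i)) / (45 * 5 ^ n)))"
    unfolding graph_form_def sum_subtractf[symmetric] by simp
  also have "\<dots> = - flux_form n (spline_state m g p) v -
      (5/3) ^ n * ((\<Sum>w\<in>words n. \<Sum>i\<in>UNIV. ?P w i * v (corner q w i)) / (45 * 5 ^ n))"
    unfolding flux_form_def sum_negf sum_divide_distrib[symmetric] by (simp only: right_diff_distrib mult_minus_right)
  also have "(5/3) ^ n * ((\<Sum>w\<in>words n. \<Sum>i\<in>UNIV. ?P w i * v (corner q w i)) / (45 * 5 ^ n)) =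
      (\<Sum>w\<in>words n. \<Sum>i\<in>UNIV. ?P w i * v (corner q w i)) / (45 * 3 ^ n)"
    by (simp add: power_divide)
  finally show ?thesis
    using flux_form_spline[OF assms] by simp
qed

text \<open>Every product of corner values averages to the same integral. The weights total 3 + 3 *
  4 = 15 per corner and 45 per cell, matching the denominator.\<close>

lemma spline_source_tendsto:
  fixes P v :: "real^2 \<Rightarrow> real"
  assumes P: "continuous_on (SG q) P" and v: "continuous_on (SG q) v"
  shows "(\<lambda>n. (\<Sum>w\<in>words n. \<Sum>i\<in>UNIV. (3 * P (corner q w i) + 4 * (\<Sum>j\<in>UNIV. P (corner q w j))) *
    v (corner q w i)) / (45 * 3 ^ n)) \<longlonglongrightarrow> (\<integral>x. P x * v x \<partial>gasket_measure q)"
proof -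
  define R where "R n i j = (\<Sum>w\<in>words n. P (corner q w i) * v (corner q w j)) / 3 ^ n" for n i j
  have R: "(\<lambda>n. R n i j) \<longlonglongrightarrow> (\<integral>x. P x * v x \<partial>gasket_measure q)" for i j
    unfolding R_def by (rule Riemann_sum_product_tendsto[OF gasket_measure P v])
  have "(\<lambda>n. (\<Sum>i\<in>UNIV. 3 * R n i i + 4 * (\<Sum>j\<in>UNIV. R n j i)) / 45) \<longlonglongrightarrow>
      (\<Sum>i\<in>(UNIV :: 3 set). 3 * (\<integral>x. P x * v x \<partial>gasket_measure q) +
        4 * (\<Sum>j\<in>(UNIV :: 3 set). (\<integral>x. P x * v x \<partial>gasket_measure q))) / 45"
    by (intro tendsto_intros R) simp
  also have "(\<lambda>n. (\<Sum>i\<in>UNIV. 3 * R n i i + 4 * (\<Sum>j\<in>UNIV. R n j i)) / 45) =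
      (\<lambda>n. (\<Sum>w\<in>words n. \<Sum>i\<in>UNIV. (3 * P (corner q w i) + 4 * (\<Sum>j\<in>UNIV. P (corner q w j))) *
        v (corner q w i)) / (45 * 3 ^ n))"
    unfolding R_def sum_3 distrib_right distrib_left sum.distrib mult.assoc sum_distrib_left[symmetric]
    by (simp add: algebra_simps flip: add_divide_distrib)
  finally show ?thesis
    by simp
qed

lemma graph_form_spline_tendsto:
  assumes "continuous_on (SG q) v"
  shows "(\<lambda>n. graph_form n (spline m g p) v) \<longlonglongrightarrow>
    - flux_form m (spline_state m g p) v - (\<integral>x. spline m p (\<lambda>_. 0) x * v x \<partial>gasket_measure q)"
proof (rule Lim_transform_eventually)
  show "(\<lambda>n. - flux_form m (spline_state m g p) v -
    (\<Sum>w\<in>words n. \<Sum>i\<in>UNIV. (3 * spline m p (\<lambda>_. 0) (corner q w i) +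
       4 * (\<Sum>j\<in>UNIV. spline m p (\<lambda>_. 0) (corner q w j))) * v (corner q w i)) / (45 * 3 ^ n)) \<longlonglongrightarrow>
    - flux_form m (spline_state m g p) v - (\<integral>x. spline m p (\<lambda>_. 0) x * v x \<partial>gasket_measure q)"
    by (intro tendsto_intros spline_source_tendsto continuous_spline assms)
qed (use graph_form_spline in \<open>auto simp: eventually_sequentially intro!: exI[of _ m]\<close>)

text \<open>The limit formula asks only for a continuous \<open>v\<close>, so the spline may be
  paired with itself; its convergent graph energies are bounded.\<close>

lemma spline_in_dom_energy: "spline m g p \<in> dom_energy q"
proof -
  have "convergent (\<lambda>n. graph_form n (spline m g p) (spline m g p))"
    using graph_form_spline_tendsto[OF continuous_spline] by (rule convergentI)
  then have "Bseq (\<lambda>n. graph_form n (spline m g p) (spline m g p))"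
    by (rule convergent_imp_Bseq)
  then show ?thesis
    using continuous_spline by (auto simp: dom_energy_iff Bseq_def) (metis abs_le_D1)
qed

lemma energy_form_spline:
  assumes "v \<in> dom_energy q"
  shows "energy_form q (spline m g p) v =
    - flux_form m (spline_state m g p) v - (\<integral>x. spline m p (\<lambda>_. 0) x * v x \<partial>gasket_measure q)"
  using energy_form_tendsto[OF spline_in_dom_energy assms]
    graph_form_spline_tendsto[OF dom_energy_continuous[OF assms]]
  by (rule LIMSEQ_unique)

text \<open>The maximum principle holds at all vertices of the cell and passes to the whole cell by
  density. It makes fine harmonic splines uniform approximations of continuous functions.\<close>

lemma harmonic_spline_near:
  assumes w: "length w = m" and near: "\<And>j. \<bar>g (corner q w j) - c\<bar> \<le> e"
    and x: "x \<in> F_word q w ` SG q"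
  shows "\<bar>spline m g (\<lambda>_. 0) x - c\<bar> \<le> e"
proof -
  have "\<forall>j. \<bar>fst (spline_state m g (\<lambda>_. 0) (w @ v)) j - c\<bar> \<le> e" for v
  proof (induction v rule: rev_induct)
    case (snoc i v)
    have "fst (spline_state m g (\<lambda>_. 0) (w @ v @ [i])) =
        harmonic_step i (fst (spline_state m g (\<lambda>_. 0) (w @ v)))"
      using spline_state_snoc[of m "w @ v" g "\<lambda>_. 0" i] w snd_spline_state_0[of m g "w @ v"]
      by (auto simp: biharmonic_step_def case_prod_beta)
    then show ?case
      using harmonic_step_near snoc by auto
  qed (use near w in \<open>auto simp: spline_state_coarse corner_vals_def\<close>)
  then have V: "\<bar>spline m g (\<lambda>_. 0) y - c\<bar> \<le> e" if "y \<in> (\<Union>v. range (corner q (w @ v)))" for y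
    using that corner_vals_spline[of m g "\<lambda>_. 0"] by (auto simp: corner_vals_def fun_eq_iff)
  let ?A = "\<Union>v. range (corner q (w @ v))"
  have "closure ?A \<subseteq> SG q"
    by (intro closure_minimal compact_imp_closed compact_SG) auto
  then have "continuous_on (closure ?A) (\<lambda>y. \<bar>spline m g (\<lambda>_. 0) y - c\<bar>)"
    by (intro continuous_intros continuous_on_subset[OF continuous_spline])
  then show ?thesis
    by (rule continuous_le_on_closure) (use x cell_subset_closure V in auto)
qed

end


section \<open>The equation at the vertices\<close>

text \<open>Elimination of one unknown replaces the form by its Schur complement, which is again positive
  definite.\<close>

lemma positive_definite_system_solvable:
  fixes K :: "'a \<Rightarrow> 'a \<Rightarrow> real"
  assumes "finite A"
    and "\<And>c. \<exists>z\<in>A. c z \<noteq> 0 \<Longrightarrow> 0 < (\<Sum>z\<in>A. c z * (\<Sum>y\<in>A. K z y * c y))"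
  shows "\<exists>c. \<forall>z\<in>A. (\<Sum>y\<in>A. K z y * c y) = b z"
  using assms
proof (induction A arbitrary: K b rule: finite_induct)
  case (insert t A)
  note fin = insert.hyps(1) and t = insert.hyps(2) and pos = insert.prems
  have split: "(\<Sum>y\<in>insert t A. h y) = h t + (\<Sum>y\<in>A. h y)" for h :: "'a \<Rightarrow> real"
    using fin t by simp
  have upd: "(\<Sum>y\<in>A. h y ((c(t := a)) y)) = (\<Sum>y\<in>A. h y (c y))" for h :: "'a \<Rightarrow> real \<Rightarrow> real" and c a
    using t by (intro sum.cong) auto
  have Ktt: "K t t > 0"
  proof -
    have "(\<Sum>z\<in>A. ((\<lambda>_. 0)(t := 1)) z * h z) = 0" "(\<Sum>z\<in>A. h z * ((\<lambda>_. 0)(t := 1)) z) = 0"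
      for h :: "'a \<Rightarrow> real"
      using t by (auto intro!: sum.neutral)
    then show ?thesis
      using pos[of "(\<lambda>_. 0)(t := 1)"] unfolding split by simp
  qed
  define K' where "K' z y = K z y - K z t * K t y / K t t" for z y
  have K': "(\<Sum>y\<in>A. K' z y * c y) = (\<Sum>y\<in>A. K z y * c y) - K z t / K t t * (\<Sum>y\<in>A. K t y * c y)" for z c
    by (simp add: K'_def left_diff_distrib sum_subtractf sum_distrib_left mult.assoc)
  have "0 < (\<Sum>z\<in>A. c z * (\<Sum>y\<in>A. K' z y * c y))" if "\<exists>z\<in>A. c z \<noteq> 0" for c
  proof -
    \<comment> \<open>This value makes row \<open>t\<close> vanish at the extended vector
      \<open>d\<close>, so the form of \<open>K\<close> at \<open>d\<close> is the form of the Schur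
      complement \<open>K'\<close> at \<open>c\<close>.\<close>
    define a where "a = - (\<Sum>y\<in>A. K t y * c y) / K t t"
    define d where "d = c(t := a)"
    have sum_d: "(\<Sum>y\<in>A. K z y * d y) = (\<Sum>y\<in>A. K z y * c y)" for z
      unfolding d_def by (rule upd)
    have "\<exists>z\<in>insert t A. d z \<noteq> 0"
      using that t by (auto simp: d_def)
    from pos[OF this] have "0 < d t * (K t t * d t + (\<Sum>y\<in>A. K t y * c y)) +
        (\<Sum>z\<in>A. d z * (K z t * d t + (\<Sum>y\<in>A. K z y * c y)))"
      unfolding split sum_d .
    also have "K t t * d t + (\<Sum>y\<in>A. K t y * c y) = 0"
      using Ktt by (simp add: d_def a_def)
    also have "(\<Sum>z\<in>A. d z * (K z t * d t + (\<Sum>y\<in>A. K z y * c y))) =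
        (\<Sum>z\<in>A. c z * (\<Sum>y\<in>A. K' z y * c y))"
    proof (rule sum.cong[OF refl])
      fix z assume "z \<in> A"
      then have "d z = c z"
        using t by (auto simp: d_def)
      then show "d z * (K z t * d t + (\<Sum>y\<in>A. K z y * c y)) = c z * (\<Sum>y\<in>A. K' z y * c y)"
        unfolding K' by (simp add: d_def a_def)
    qed
    finally show ?thesis by simp
  qed
  then obtain c where c: "\<And>z. z \<in> A \<Longrightarrow> (\<Sum>y\<in>A. K' z y * c y) = b z - K z t * b t / K t t"
    using insert.IH[of K' "\<lambda>z. b z - K z t * b t / K t t"] by blast
  define d where "d = c(t := (b t - (\<Sum>y\<in>A. K t y * c y)) / K t t)"
  have sum_d: "(\<Sum>y\<in>A. K z y * d y) = (\<Sum>y\<in>A. K z y * c y)" for z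
    unfolding d_def by (rule upd)
  have "(\<Sum>y\<in>insert t A. K z y * d y) = b z" if "z \<in> insert t A" for z
  proof (cases "z = t")
    case True
    then show ?thesis
      unfolding split sum_d using Ktt by (simp add: d_def)
  next
    case False
    then show ?thesis
      unfolding split sum_d using that c[of z] Ktt unfolding K' by (simp add: d_def field_simps)
  qed
  then show ?case by blast
qed simp

context gasket
begin

section \<open>Vertices, cells and edges of one level\<close>

definition fibre :: "nat \<Rightarrow> real^2 \<Rightarrow> (3 list \<times> 3) set" where
  "fibre m z = {(w, i). w \<in> words m \<and> corner q w i = z}"

lemma finite_fibre [simp]: "finite (fibre m z)"
  by (rule finite_subset[of _ "words m \<times> UNIV"]) (auto simp: fibre_def)

lemma fibre_boundary: "fibre m (q b) = {(replicate m b, b)}"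
proof -
  have "w = replicate m b \<and> i = b" if "w \<in> words m" "corner q w i = q b" for w i
    using F_word_eq_q[of w "q i" b] that by (simp add: corner_def words_def inj_q)
  then show ?thesis
    by (auto simp: fibre_def words_def corner_def)
qed

lemma card_fibre_Suc:
  "card (fibre (Suc m) z) = (\<Sum>a\<in>UNIV. card {(w, i). w \<in> words m \<and> F q a (corner q w i) = z})"
proof -
  let ?N = "\<lambda>a. {(w, i). w \<in> words m \<and> F q a (corner q w i) = z}"
  let ?h = "\<lambda>(a, w, i). (a # w, i)"
  have fin: "finite (?N a)" for a
    by (rule finite_subset[of _ "words m \<times> UNIV"]) auto
  have "fibre (Suc m) z = ?h ` (SIGMA a:UNIV. ?N a)"
  proof (intro equalityI subsetI)
    fix s assume "s \<in> fibre (Suc m) z"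
    then obtain a w i where "s = (a # w, i)" "w \<in> words m" "F q a (corner q w i) = z"
      by (cases s) (auto simp: fibre_def words_def length_Suc_conv)
    then show "s \<in> ?h ` (SIGMA a:UNIV. ?N a)"
      by (intro image_eqI[of _ _ "(a, w, i)"]) auto
  qed (auto simp: fibre_def words_def)
  moreover have "inj_on ?h (SIGMA a:UNIV. ?N a)"
    by (auto simp: inj_on_def)
  ultimately show ?thesis
    using fin by (simp add: card_image card_SigmaI)
qed

text \<open>Induction over the first letter. If two first-level cells contain \<open>z\<close>, it
  is their common point, a boundary vertex of each, and has one address in each by
  \<open>fibre_boundary\<close>. Otherwise all addresses start with \<open>a\<close>, and the
  preimage \<open>x\<close> is not a boundary vertex, so the induction hypothesis applies.\<close>

lemma card_fibre:
  assumes "z \<in> V q m" "z \<notin> V q 0"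
  shows "card (fibre m z) = 2"
  using assms
proof (induction m arbitrary: z)
  case (Suc m)
  let ?N = "\<lambda>a. {(w, i). w \<in> words m \<and> F q a (corner q w i) = z}"
  obtain a x where x: "z = F q a x" "x \<in> V q m"
    using Suc.prems(1) by auto
  have xSG: "x \<in> SG q"
    using x(2) V_subset_SG by blast
  have Na: "?N a = fibre m x"
    by (auto simp: fibre_def x(1))
  have N: "?N b = {}" if "\<And>y. y \<in> SG q \<Longrightarrow> z \<noteq> F q b y" for b
    using that corner_in_SG by force
  show ?case
  proof (cases "\<exists>b y. b \<noteq> a \<and> y \<in> SG q \<and> z = F q b y")
    case True
    then obtain b y where b: "b \<noteq> a" "y \<in> SG q" "z = F q b y"
      by blast
    have xy: "x = q b" "y = q a"
      using F_eq_F[of a x b y] b xSG x(1) by auto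
    have Nb: "?N b = fibre m y"
      by (auto simp: fibre_def b(3))
    have E: "?N c = {}" if "c \<noteq> a" "c \<noteq> b" for c
    proof (rule N, rule notI)
      fix y' assume "y' \<in> SG q" "z = F q c y'"
      then have "x = q c"
        using F_eq_F[of a x c y'] that(1) xSG x(1) by auto
      then show False
        using xy that(2) inj_q by simp
    qed
    have "card (?N c) = 0" if "c \<in> UNIV - {a, b}" for c
      by (subst E) (use that in auto)
    then have "(\<Sum>c\<in>UNIV. card (?N c)) = (\<Sum>c\<in>{a, b}. card (?N c))"
      by (intro sum.mono_neutral_right ballI) simp_all
    also have "\<dots> = 2"
      using b(1) unfolding sum.insert[OF finite.emptyI[THEN finite.insertI], of a b]
      by (simp add: Na Nb xy fibre_boundary)
    finally show ?thesis
      by (simp add: card_fibre_Suc)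
  next
    case False
    have "x \<notin> V q 0"
    proof
      assume "x \<in> V q 0"
      then obtain b where "x = q b" by auto
      then have "z = F q b (q a)"
        using x(1) F_swap by metis
      with False have "b = a"
        using q_in_SG by blast
      then show False
        using Suc.prems(2) x(1) \<open>x = q b\<close> by simp
    qed
    have E: "?N c = {}" if "c \<noteq> a" for c
      using N False that by blast
    have "card (?N c) = 0" if "c \<in> UNIV - {a}" for c
      by (subst E) (use that in auto)
    then have "(\<Sum>c\<in>UNIV. card (?N c)) = (\<Sum>c\<in>{a}. card (?N c))"
      by (intro sum.mono_neutral_right ballI) simp_all
    then show ?thesis
      using Suc.IH[OF x(2) \<open>x \<notin> V q 0\<close>] Na by (simp add: card_fibre_Suc)
  qed
qed simp

lemma sum_over_vertices:
  fixes h :: "3 list \<Rightarrow> 3 \<Rightarrow> real"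
  shows "(\<Sum>w\<in>words m. \<Sum>i\<in>UNIV. h w i) = (\<Sum>z\<in>V q m. \<Sum>(w, i)\<in>fibre m z. h w i)"
proof -
  have "{s \<in> words m \<times> UNIV. corner q (fst s) (snd s) = z} = fibre m z" for z
    by (auto simp: fibre_def)
  moreover have "(\<lambda>s. corner q (fst s) (snd s)) ` (words m \<times> UNIV) \<subseteq> V q m"
    by (auto simp: V_eq_corner)
  ultimately have "(\<Sum>z\<in>V q m. \<Sum>(w, i)\<in>fibre m z. h w i) = (\<Sum>(w, i)\<in>words m \<times> UNIV. h w i)"
    using sum.group[of "words m \<times> UNIV" "V q m" "\<lambda>s. corner q (fst s) (snd s)" "\<lambda>(w, i). h w i"] by simp
  then show ?thesis
    by (simp add: sum.cartesian_product)
qed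

text \<open>Although \<open>z\<close> may lie in two cells, no neighbour is counted twice, since an
  edge determines its cell.\<close>

lemma sum_neighbours:
  fixes h :: "real^2 \<Rightarrow> real"
  shows "(\<Sum>y | adjacent q m y z. h y) = (\<Sum>(w, i)\<in>fibre m z. \<Sum>j\<in>UNIV - {i}. h (corner q w j))"
proof -
  let ?S = "SIGMA s:fibre m z. UNIV - {snd s}"
  let ?h = "\<lambda>s. corner q (fst (fst s)) (snd s)"
  have "inj_on ?h ?S"
  proof (rule inj_onI)
    fix s t assume st: "s \<in> ?S" "t \<in> ?S" "?h s = ?h t"
    obtain w i j w' i' j' where eq: "s = ((w, i), j)" "t = ((w', i'), j')"
      by (metis prod.exhaust)
    have "w = w' \<and> i = i' \<and> j = j'"
      by (rule edge_word_unique) (use st in \<open>auto simp: eq words_def fibre_def\<close>)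
    then show "s = t"
      by (simp add: eq)
  qed
  moreover have "?h ` ?S = {y. adjacent q m y z}"
  proof (intro equalityI subsetI)
    fix y assume "y \<in> {y. adjacent q m y z}"
    then obtain w i j where "w \<in> words m" "j \<noteq> i" "y = corner q w j" "z = corner q w i"
      using adjacent_iff[of m y z] by auto
    then show "y \<in> ?h ` ?S"
      by (intro image_eqI[of _ _ "((w, i), j)"]) (auto simp: fibre_def)
  next
    fix y assume "y \<in> ?h ` ?S"
    then obtain s where s: "s \<in> ?S" "y = ?h s"
      by blast
    obtain w i j where "s = ((w, i), j)"
      by (metis prod.exhaust)
    with s have "w \<in> words m" "j \<noteq> i" "z = corner q w i" "y = corner q w j"
      by (auto simp: fibre_def)
    then show "y \<in> {y. adjacent q m y z}"
      unfolding adjacent_iff by blast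
  qed
  ultimately have "(\<Sum>y | adjacent q m y z. h y) = (\<Sum>s\<in>?S. h (?h s))"
    by (intro sum.reindex_cong[of ?h]) auto
  also have "\<dots> = (\<Sum>s\<in>fibre m z. \<Sum>j\<in>UNIV - {snd s}. h (corner q (fst s) j))"
    by (subst sum.Sigma) (auto simp: case_prod_beta)
  finally show ?thesis
    by (simp add: case_prod_beta)
qed

lemma sum_except:
  fixes h :: "3 \<Rightarrow> real"
  shows "(\<Sum>j\<in>UNIV. h j) = h i + (\<Sum>j\<in>UNIV - {i}. h j)"
  by (simp add: sum.remove)

text \<open>Each cell at \<open>z\<close> contributes 3 + 4 = 7 for \<open>z\<close> itself and 4
  for each of its other corners; two cells meet at \<open>z\<close>, giving 14.\<close>

lemma sum_fibre_source:
  fixes p :: "real^2 \<Rightarrow> real"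
  assumes "z \<in> V q m" "z \<notin> V q 0"
  shows "(\<Sum>(w, i)\<in>fibre m z. 3 * p (corner q w i) + 4 * (\<Sum>j\<in>UNIV. p (corner q w j))) =
    14 * p z + 4 * (\<Sum>y | adjacent q m y z. p y)"
proof -
  have "(\<Sum>(w, i)\<in>fibre m z. 3 * p (corner q w i) + 4 * (\<Sum>j\<in>UNIV. p (corner q w j))) =
      (\<Sum>(w, i)\<in>fibre m z. 7 * p z + 4 * (\<Sum>j\<in>UNIV - {i}. p (corner q w j)))"
  proof (intro sum.cong refl)
    fix s assume "s \<in> fibre m z"
    then obtain w i where "s = (w, i)" "corner q w i = z"
      by (auto simp: fibre_def)
    then show "(case s of (w, i) \<Rightarrow> 3 * p (corner q w i) + 4 * (\<Sum>j\<in>UNIV. p (corner q w j))) =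
        (case s of (w, i) \<Rightarrow> 7 * p z + 4 * (\<Sum>j\<in>UNIV - {i}. p (corner q w j)))"
      using sum_except[of "\<lambda>j. p (corner q w j)" i] by simp
  qed
  also have "\<dots> = 14 * p z + 4 * (\<Sum>y | adjacent q m y z. p y)"
    unfolding sum_neighbours
    by (simp add: case_prod_beta sum.distrib card_fibre[OF assms] sum_distrib_left)
  finally show ?thesis .
qed

text \<open>The identity of the theorem is thereby the statement that the fluxes into
  \<open>z\<close> from its cells cancel.\<close>

lemma sum_fibre_flux:
  assumes "z \<in> V q m" "z \<notin> V q 0"
  shows "(\<Sum>(w, i)\<in>fibre m z. flux (spline_state m g p w) i) =
    discrete_laplacian q m g z - (14 * p z + 4 * (\<Sum>y | adjacent q m y z. p y)) / (45 * 5 ^ m)"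
proof -
  have "flux (spline_state m g p w) i = (\<Sum>j\<in>UNIV - {i}. g (corner q w j) - g z) -
      (3 * p (corner q w i) + 4 * (\<Sum>j\<in>UNIV. p (corner q w j))) / (45 * 5 ^ m)"
    if "(w, i) \<in> fibre m z" for w i
  proof -
    have w: "length w = m" and z: "corner q w i = z"
      using that by (auto simp: fibre_def words_def)
    have "(\<Sum>j\<in>UNIV. g (corner q w j)) - 3 * g z = (\<Sum>j\<in>UNIV - {i}. g (corner q w j) - g z)"
      by (simp add: sum_except[of _ i] z sum_subtractf card_Diff_singleton)
    then show ?thesis
      unfolding spline_state_coarse[OF eq_refl[OF w]] flux_def case_prod_conv corner_vals_def z w
      by (simp add: sum_divide_distrib[symmetric] field_simps)
  qed
  then have "(\<Sum>(w, i)\<in>fibre m z. flux (spline_state m g p w) i) =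
      (\<Sum>(w, i)\<in>fibre m z. (\<Sum>j\<in>UNIV - {i}. g (corner q w j) - g z) -
      (3 * p (corner q w i) + 4 * (\<Sum>j\<in>UNIV. p (corner q w j))) / (45 * 5 ^ m))"
    by (intro sum.cong) auto
  also have "\<dots> = (\<Sum>(w, i)\<in>fibre m z. \<Sum>j\<in>UNIV - {i}. g (corner q w j) - g z) -
      (\<Sum>(w, i)\<in>fibre m z. 3 * p (corner q w i) + 4 * (\<Sum>j\<in>UNIV. p (corner q w j))) / (45 * 5 ^ m)"
    unfolding case_prod_beta sum_subtractf sum_divide_distrib[symmetric] ..
  finally show ?thesis
    by (simp only: sum_fibre_source[OF assms] discrete_laplacian_def sum_neighbours[where h = "\<lambda>y. g y - g z"])
qed

lemma discrete_equation_solvable: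
  fixes b :: "real^2 \<Rightarrow> real"
  shows "\<exists>p. (\<forall>z\<in>V q 0. p z = 0) \<and>
    (\<forall>z\<in>V q m - V q 0. 14 * p z + 4 * (\<Sum>y | adjacent q m y z. p y) = b z)"
proof -
  let ?A = "V q m - V q 0"
  define K where "K z y = (if y = z then 14 else 0) + (if adjacent q m y z then 4 else 0 :: real)" for z y
  have row: "(\<Sum>y\<in>?A. K z y * c y) = 14 * c z + 4 * (\<Sum>y | adjacent q m y z. c y)"
    if c: "\<And>z. z \<notin> ?A \<Longrightarrow> c z = 0" and z: "z \<in> ?A" for c z
  proof -
    have fin: "finite {y. adjacent q m y z}"
      by (rule finite_subset[of _ "V q m"]) (auto simp: adjacent_iff V_eq_corner)
    have "(\<Sum>y\<in>?A. K z y * c y) =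
        (\<Sum>y\<in>?A. if y = z then 14 * c y else 0) + (\<Sum>y\<in>?A. if adjacent q m y z then 4 * c y else 0)"
      unfolding sum.distrib[symmetric] by (intro sum.cong) (auto simp: K_def)
    also have "(\<Sum>y\<in>?A. if y = z then 14 * c y else 0) = 14 * c z"
      using z by (subst sum.delta) auto
    also have "(\<Sum>y\<in>?A. if adjacent q m y z then 4 * c y else 0) = (\<Sum>y\<in>?A \<inter> {y. adjacent q m y z}. 4 * c y)"
      by (simp add: sum.inter_restrict)
    also have "\<dots> = (\<Sum>y | adjacent q m y z. 4 * c y)"
    proof (intro sum.mono_neutral_left fin ballI)
      fix y assume "y \<in> {y. adjacent q m y z} - ?A \<inter> {y. adjacent q m y z}"
      then have "c y = 0"
        using c[of y] by blast
      then show "4 * c y = 0"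
        by simp
    qed auto
    finally show ?thesis
      by (simp add: sum_distrib_left)
  qed
  have pos: "0 < (\<Sum>z\<in>?A. c z * (\<Sum>y\<in>?A. K z y * c y))" if ne: "\<exists>z\<in>?A. c z \<noteq> 0" for c
  proof -
    \<comment> \<open>Extension by zero lets the sum run over all of \<open>V q m\<close>, boundary
      included, where it can be regrouped by cells.\<close>
    define d where "d z = (if z \<in> ?A then c z else 0)" for z
    have d: "d z = 0" if "z \<notin> ?A" for z
      using that unfolding d_def by (rule if_not_P)
    have "(\<Sum>z\<in>?A. c z * (\<Sum>y\<in>?A. K z y * c y)) = (\<Sum>z\<in>?A. d z * (\<Sum>y\<in>?A. K z y * d y))"
      by (intro sum.cong refl) (simp_all add: d_def del: V.simps)
    also have "\<dots> = (\<Sum>z\<in>?A. d z * (14 * d z + 4 * (\<Sum>y | adjacent q m y z. d y)))"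
      by (intro sum.cong refl arg_cong2[of _ _ _ _ "(*)"] row d)
    also have "\<dots> = (\<Sum>z\<in>?A. \<Sum>(w, i)\<in>fibre m z.
        d (corner q w i) * (3 * d (corner q w i) + 4 * (\<Sum>j\<in>UNIV. d (corner q w j))))"
    proof (rule sum.cong[OF refl])
      fix z assume z: "z \<in> ?A"
      show "d z * (14 * d z + 4 * (\<Sum>y | adjacent q m y z. d y)) = (\<Sum>(w, i)\<in>fibre m z.
        d (corner q w i) * (3 * d (corner q w i) + 4 * (\<Sum>j\<in>UNIV. d (corner q w j))))"
        using z by (subst sum_fibre_source[symmetric])
          (auto simp: sum_distrib_left case_prod_beta fibre_def intro!: sum.cong)
    qed
    also have "\<dots> = (\<Sum>z\<in>V q m. \<Sum>(w, i)\<in>fibre m z.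
        d (corner q w i) * (3 * d (corner q w i) + 4 * (\<Sum>j\<in>UNIV. d (corner q w j))))"
      by (intro sum.mono_neutral_left) (auto simp: fibre_def d intro!: sum.neutral)
    also have "\<dots> = (\<Sum>w\<in>words m. \<Sum>i\<in>UNIV.
        d (corner q w i) * (3 * d (corner q w i) + 4 * (\<Sum>j\<in>UNIV. d (corner q w j))))"
      by (rule sum_over_vertices[symmetric])
    also have "\<dots> = (\<Sum>w\<in>words m. 3 * (\<Sum>i\<in>UNIV. (d (corner q w i))\<^sup>2) + 4 * (\<Sum>i\<in>UNIV. d (corner q w i))\<^sup>2)"
      by (intro sum.cong refl)
         (simp add: power2_eq_square distrib_left sum.distrib sum_distrib_left sum_distrib_right mult_ac)
    also have "\<dots> > 0"
    proof -
      obtain z where z: "z \<in> V q m" "d z \<noteq> 0"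
        using ne unfolding d_def by (metis DiffD1)
      then obtain w i where w: "w \<in> words m" "z = corner q w i"
        by (auto simp: V_eq_corner)
      have "(d z)\<^sup>2 \<le> (\<Sum>i\<in>UNIV. (d (corner q w i))\<^sup>2)"
        unfolding w(2) by (rule member_le_sum) auto
      moreover have "0 < (d z)\<^sup>2"
        using z(2) by simp
      moreover have "0 \<le> 4 * (\<Sum>i\<in>UNIV. d (corner q w i))\<^sup>2"
        by simp
      ultimately have "0 < 3 * (\<Sum>i\<in>UNIV. (d (corner q w i))\<^sup>2) + 4 * (\<Sum>i\<in>UNIV. d (corner q w i))\<^sup>2"
        by linarith
      then show ?thesis
        by (intro sum_pos2[OF finite_words w(1)]) (auto intro!: add_nonneg_nonneg sum_nonneg)
    qed
    finally show ?thesis .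
  qed
  have "\<exists>c. \<forall>z\<in>?A. (\<Sum>y\<in>?A. K z y * c y) = b z"
    by (rule positive_definite_system_solvable[OF finite_Diff[OF finite_V] pos])
  then obtain c where c: "\<forall>z\<in>?A. (\<Sum>y\<in>?A. K z y * c y) = b z" ..
  define p where "p z = (if z \<in> ?A then c z else 0)" for z
  have "14 * p z + 4 * (\<Sum>y | adjacent q m y z. p y) = b z" if z: "z \<in> ?A" for z
  proof -
    have "b z = (\<Sum>y\<in>?A. K z y * p y)"
      unfolding bspec[OF c z, symmetric] by (intro sum.cong refl) (simp add: p_def del: V.simps)
    also have "\<dots> = 14 * p z + 4 * (\<Sum>y | adjacent q m y z. p y)"
      by (rule row) (use z in \<open>auto simp: p_def simp del: V.simps\<close>)
    finally show ?thesis by simp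
  qed
  then show ?thesis
    by (intro exI[of _ p]) (auto simp: p_def simp del: V.simps)
qed

text \<open>Grouped by vertices, the boundary term is total flux times the value of
  \<open>v\<close>: the first factor vanishes at interior vertices, the second on the
  boundary.\<close>

lemma flux_form_eq_0:
  assumes "\<And>z. z \<in> V q m - V q 0 \<Longrightarrow> discrete_laplacian q m g z =
      (14 * p z + 4 * (\<Sum>y | adjacent q m y z. p y)) / (45 * 5 ^ m)"
    and "\<And>z. z \<in> V q 0 \<Longrightarrow> v z = 0"
  shows "flux_form m (spline_state m g p) v = 0"
proof -
  have "(\<Sum>(w, i)\<in>fibre m z. flux (spline_state m g p w) i * v (corner q w i)) = 0" if z: "z \<in> V q m" for z
  proof -
    have "(\<Sum>(w, i)\<in>fibre m z. flux (spline_state m g p w) i * v (corner q w i)) =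
        (\<Sum>(w, i)\<in>fibre m z. flux (spline_state m g p w) i) * v z"
      by (auto simp: sum_distrib_right case_prod_beta fibre_def intro!: sum.cong)
    also have "\<dots> = 0"
    proof (cases "z \<in> V q 0")
      case False
      then show ?thesis
        using z assms(1)[of z] by (subst sum_fibre_flux) auto
    qed (simp only: assms(2) mult_zero_right)
    finally show ?thesis .
  qed
  then show ?thesis
    by (simp add: flux_form_def sum_over_vertices)
qed

lemma has_laplacian_spline:
  assumes "\<And>z. z \<in> V q m - V q 0 \<Longrightarrow> discrete_laplacian q m g z =
      (14 * p z + 4 * (\<Sum>y | adjacent q m y z. p y)) / (45 * 5 ^ m)"
  shows "has_laplacian q (spline m g p) (spline m p (\<lambda>_. 0))"
  unfolding has_laplacian_def
proof (intro conjI ballI impI)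
  show "spline m g p \<in> dom_energy q"
    by (rule spline_in_dom_energy)
  show "spline m p (\<lambda>_. 0) \<in> borel_measurable (gasket_measure q)"
    by (intro continuous_measurable sets_gasket_measure continuous_spline)
  show "integrable (gasket_measure q) (\<lambda>x. (spline m p (\<lambda>_. 0) x)\<^sup>2)"
    by (intro continuous_integrable gasket_measure continuous_intros continuous_spline)
  fix v assume "v \<in> dom_energy q" "\<forall>x\<in>V q 0. v x = 0"
  then show "energy_form q (spline m g p) v = - (\<integral>x. spline m p (\<lambda>_. 0) x * v x \<partial>gasket_measure q)"
    using flux_form_eq_0[where m = m and g = g and p = p and v = v] assms by (simp del: V.simps add: energy_form_spline)
qed

end


section \<open>The Laplacian of the minimizer\<close>

context gasket
begin

section \<open>Test functions determine the Laplacian\<close>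

lemma vertex_null: "measure (gasket_measure q) {q i} = 0"
proof -
  have "measure (gasket_measure q) {q i} \<le> (1/3) ^ n" for n
  proof -
    have "{q i} \<subseteq> F_word q (replicate n i) ` SG q"
      using imageI[of "q i" "SG q" "F_word q (replicate n i)"] by simp
    then have "measure (gasket_measure q) {q i} \<le> measure (gasket_measure q) (F_word q (replicate n i) ` SG q)"
      using cell_measurable by (intro \<mu>.finite_measure_mono) (auto simp: sets_gasket_measure)
    then show ?thesis
      using gasket_measure by (simp add: cell_measure_def)
  qed
  moreover have "(\<lambda>n. (1/3 :: real) ^ n) \<longlonglongrightarrow> 0"
    by (rule LIMSEQ_power_zero) simp
  ultimately have "measure (gasket_measure q) {q i} \<le> 0"
    by (intro LIMSEQ_le_const) auto
  then show ?thesis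
    using measure_nonneg[of "gasket_measure q" "{q i}"] by linarith
qed

lemma AE_not_boundary: "AE x in gasket_measure q. x \<notin> V q 0"
proof -
  have "AE x in gasket_measure q. x \<noteq> q i" for i
  proof (rule AE_I[of _ _ "{q i}"])
    show "emeasure (gasket_measure q) {q i} = 0"
      by (simp add: \<mu>.emeasure_eq_measure vertex_null)
    show "{q i} \<in> sets (gasket_measure q)"
      by (simp add: sets_gasket_measure sets_restrict_SG)
  qed auto
  then have "AE x in gasket_measure q. \<forall>i\<in>UNIV. x \<noteq> q i"
    by (intro AE_finite_allI) auto
  then show ?thesis
    by eventually_elim auto
qed

text \<open>A harmonic spline on a fine level is uniformly close to \<open>\<phi>\<close>, has
  finite energy and inherits the zeros of \<open>\<phi>\<close> on \<open>V q 0\<close>. The error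
  in the integral is at most the uniform distance times the integral of
  \<open>\<bar>h x\<bar>\<close>.\<close>

lemma orthogonal_continuous:
  assumes h: "integrable (gasket_measure q) h"
    and orth: "\<And>v. v \<in> dom_energy q \<Longrightarrow> \<forall>x\<in>V q 0. v x = 0 \<Longrightarrow> (\<integral>x. h x * v x \<partial>gasket_measure q) = 0"
    and \<phi>: "continuous_on (SG q) \<phi>" "\<And>x. x \<in> V q 0 \<Longrightarrow> \<phi> x = 0"
  shows "(\<integral>x. h x * \<phi> x \<partial>gasket_measure q) = (0 :: real)"
proof -
  let ?\<mu> = "gasket_measure q"
  have int: "integrable ?\<mu> (\<lambda>x. h x * \<psi> x)" if \<psi>: "continuous_on (SG q) \<psi>" for \<psi> :: "real^2 \<Rightarrow> real"
  proof -
    obtain B where B: "B \<ge> 0" "\<And>x. x \<in> SG q \<Longrightarrow> \<bar>\<psi> x\<bar> \<le> B"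
      using continuous_bounded[OF \<psi>] by metis
    have [measurable]: "\<psi> \<in> borel_measurable ?\<mu>" "h \<in> borel_measurable ?\<mu>"
      using continuous_measurable[OF sets_gasket_measure \<psi>] h by auto
    show ?thesis
    proof (rule Bochner_Integration.integrable_bound)
      show "integrable ?\<mu> (\<lambda>x. B * h x)"
        using h by simp
      show "AE x in ?\<mu>. norm (h x * \<psi> x) \<le> norm (B * h x)"
        using B by (intro AE_I2) (auto simp: abs_mult mult.commute intro: mult_right_mono)
    qed measurable
  qed
  have "\<bar>\<integral>x. h x * \<phi> x \<partial>?\<mu>\<bar> \<le> e * (\<integral>x. \<bar>h x\<bar> \<partial>?\<mu>)" if e: "e > 0" for e
  proof -
    obtain n where n: "\<And>w x y. w \<in> words n \<Longrightarrow> x \<in> F_word q w ` SG q \<Longrightarrow> y \<in> F_word q w ` SG q \<Longrightarrow> \<bar>\<phi> x - \<phi> y\<bar> < e"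
      using cell_oscillation[OF \<phi>(1) e] by blast
    let ?s = "spline n \<phi> (\<lambda>_. 0)"
    have near: "\<bar>\<phi> x - ?s x\<bar> \<le> e" if x: "x \<in> SG q" for x
    proof -
      obtain w where w: "w \<in> words n" "x \<in> F_word q w ` SG q"
        using SG_cover[OF x] by blast
      have "\<bar>\<phi> (corner q w j) - \<phi> x\<bar> \<le> e" for j
        using n[OF w(1) _ w(2), of "corner q w j"] by (simp add: corner_def)
      then have "\<bar>?s x - \<phi> x\<bar> \<le> e"
        using harmonic_spline_near[of w n \<phi> "\<phi> x" e x] w by (simp add: words_def)
      then show ?thesis
        by (simp add: abs_minus_commute)
    qed
    have "?s x = 0" if "x \<in> V q 0" for x
      using spline_on_V[of x n] V_mono[of 0 n q] \<phi>(2) that by auto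
    then have "(\<integral>x. h x * ?s x \<partial>?\<mu>) = 0"
      by (intro orth spline_in_dom_energy) blast
    then have "(\<integral>x. h x * \<phi> x \<partial>?\<mu>) = (\<integral>x. h x * \<phi> x - h x * ?s x \<partial>?\<mu>)"
      by (simp add: int \<phi>(1) continuous_spline)
    also have "\<bar>\<dots>\<bar> \<le> (\<integral>x. \<bar>h x * \<phi> x - h x * ?s x\<bar> \<partial>?\<mu>)"
      by (rule integral_abs_bound)
    also have "\<dots> \<le> (\<integral>x. e * \<bar>h x\<bar> \<partial>?\<mu>)"
    proof (rule integral_mono)
      fix x assume "x \<in> space ?\<mu>"
      then have "\<bar>h x\<bar> * \<bar>\<phi> x - ?s x\<bar> \<le> \<bar>h x\<bar> * e"
        by (intro mult_left_mono near) auto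
      then show "\<bar>h x * \<phi> x - h x * ?s x\<bar> \<le> e * \<bar>h x\<bar>"
        by (simp only: right_diff_distrib[symmetric] abs_mult mult.commute[of e])
    qed (use h in \<open>auto simp: int \<phi>(1) continuous_spline\<close>)
    finally show ?thesis
      by simp
  qed
  note le = this
  define I where "I = (\<integral>x. \<bar>h x\<bar> \<partial>?\<mu>)"
  have "\<bar>\<integral>x. h x * \<phi> x \<partial>?\<mu>\<bar> \<le> 0 + e" if "e > 0" for e
  proof -
    have I: "I \<ge> 0"
      by (simp add: I_def)
    \<comment> \<open>Dividing by \<open>I + 1\<close> instead of \<open>I\<close> also covers
      \<open>I = 0\<close>.\<close>
    then have "0 < e / (I + 1)"
      using that by simp
    then have "\<bar>\<integral>x. h x * \<phi> x \<partial>?\<mu>\<bar> \<le> e / (I + 1) * I"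
      unfolding I_def by (rule le)
    also have "\<dots> \<le> e"
      using I that by (simp add: field_simps)
    finally show ?thesis by simp
  qed
  then have "\<bar>\<integral>x. h x * \<phi> x \<partial>?\<mu>\<bar> \<le> 0"
    by (rule field_le_epsilon)
  then show ?thesis by simp
qed

text \<open>The fundamental lemma of the calculus of variations on the gasket: orthogonality passes
  from test functions to continuous functions, to indicators of closed sets, and to those of all
  Borel sets.\<close>

lemma orthogonal_AE_0:
  assumes h: "integrable (gasket_measure q) h"
    and orth: "\<And>v. v \<in> dom_energy q \<Longrightarrow> \<forall>x\<in>V q 0. v x = 0 \<Longrightarrow> (\<integral>x. h x * v x \<partial>gasket_measure q) = 0"
  shows "AE x in gasket_measure q. h x = (0 :: real)"
proof (rule \<mu>.density_zero[OF h])
  let ?\<mu> = "gasket_measure q"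
  have [measurable]: "h \<in> borel_measurable ?\<mu>"
    using h by auto
  have id[measurable]: "(\<lambda>x. x) \<in> measurable ?\<mu> borel"
    by (intro continuous_measurable sets_gasket_measure continuous_intros)
  have ind: "(\<lambda>x. indicator A x :: real) \<in> borel_measurable ?\<mu>" if "A \<in> sets borel" for A
    using measurable_compose[OF id borel_measurable_indicator[OF that]] .
  have V0: "closed (V q 0)"
    by (intro finite_imp_closed finite_V)
  \<comment> \<open>Cut-offs at the boundary: \<open>\<phi> k x * (1 - \<theta> k x)\<close>
    vanishes on \<open>V q 0\<close>, and the part of \<open>C\<close> lost in the limit is
    null.\<close>
  obtain \<theta> :: "nat \<Rightarrow> real^2 \<Rightarrow> real" where \<theta>: "\<And>k A. continuous_on A (\<theta> k)"
    "\<And>k x. 0 \<le> \<theta> k x" "\<And>k x. \<theta> k x \<le> 1" "\<And>k x. x \<in> V q 0 \<Longrightarrow> \<theta> k x = 1"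
    "\<And>x. (\<lambda>k. \<theta> k x) \<longlonglongrightarrow> indicator (V q 0) x"
    by (fact closed_indicator_limit[OF V0])
  have closed: "(\<integral>x. h x * indicator C x \<partial>?\<mu>) = 0" if C: "closed C" for C
  proof -
    obtain \<phi> :: "nat \<Rightarrow> real^2 \<Rightarrow> real" where \<phi>: "\<And>k A. continuous_on A (\<phi> k)"
      "\<And>k x. 0 \<le> \<phi> k x" "\<And>k x. \<phi> k x \<le> 1" "\<And>k x. x \<in> C \<Longrightarrow> \<phi> k x = 1"
      "\<And>x. (\<lambda>k. \<phi> k x) \<longlonglongrightarrow> indicator C x"
      by (fact closed_indicator_limit[OF C])
    have [measurable]: "\<phi> k \<in> borel_measurable ?\<mu>" "\<theta> k \<in> borel_measurable ?\<mu>" for k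
      using continuous_measurable[OF sets_gasket_measure] \<phi>(1) \<theta>(1) by blast+
    have [measurable]: "(\<lambda>x. indicator C x :: real) \<in> borel_measurable ?\<mu>"
      by (intro ind borel_closed C)
    have "(\<lambda>k. \<integral>x. h x * (\<phi> k x * (1 - \<theta> k x)) \<partial>?\<mu>) \<longlonglongrightarrow> (\<integral>x. h x * indicator C x \<partial>?\<mu>)"
    proof (rule integral_dominated_convergence[where w = "\<lambda>x. \<bar>h x\<bar>"])
      show "AE x in ?\<mu>. (\<lambda>k. h x * (\<phi> k x * (1 - \<theta> k x))) \<longlonglongrightarrow> h x * indicator C x"
        using AE_not_boundary
      proof eventually_elim
        case (elim x)
        have "(\<lambda>k. h x * (\<phi> k x * (1 - \<theta> k x))) \<longlonglongrightarrow> h x * (indicator C x * (1 - indicator (V q 0) x))"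
          by (intro tendsto_intros \<phi> \<theta>)
        then show ?case
          using elim by (simp del: V.simps)
      qed
      show "AE x in ?\<mu>. norm (h x * (\<phi> k x * (1 - \<theta> k x))) \<le> \<bar>h x\<bar>" for k
      proof (rule AE_I2)
        fix x
        have "\<bar>\<phi> k x * (1 - \<theta> k x)\<bar> \<le> 1"
          using \<phi>(2,3)[of k x] \<theta>(2,3)[of k x] by (simp add: abs_mult mult_le_one)
        then have "\<bar>h x\<bar> * \<bar>\<phi> k x * (1 - \<theta> k x)\<bar> \<le> \<bar>h x\<bar> * 1"
          by (intro mult_left_mono) auto
        then show "norm (h x * (\<phi> k x * (1 - \<theta> k x))) \<le> \<bar>h x\<bar>"
          by (simp add: abs_mult)
      qed
    qed (use h in auto)
    moreover have "(\<integral>x. h x * (\<phi> k x * (1 - \<theta> k x)) \<partial>?\<mu>) = 0" for k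
      by (intro orthogonal_continuous[OF h orth] continuous_intros \<phi> \<theta>) (simp_all add: \<theta>(4) del: V.simps)
    ultimately show ?thesis
      by (simp add: LIMSEQ_const_iff)
  qed
  have int: "integrable ?\<mu> (\<lambda>x. h x * indicator A x)" if "A \<in> sets borel" for A
  proof (rule Bochner_Integration.integrable_bound[OF h])
    note [measurable] = ind[OF that]
    show "(\<lambda>x. h x * indicator A x) \<in> borel_measurable ?\<mu>"
      by measurable
  qed (auto split: split_indicator)
  have stable: "Int_stable (Collect closed :: (real^2) set set)"
    by (auto simp: Int_stable_def)
  \<comment> \<open>As \<open>h\<close> may change sign, the uniqueness theorem for measures is not
    directly at hand; instead the sets with vanishing integral are shown to be closed under
    complements and disjoint unions.\<close>
  have "(\<integral>x. h x * indicator A x \<partial>?\<mu>) = 0" if "A \<in> sigma_sets UNIV (Collect closed)" for A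
    using stable subset_UNIV[of "Collect closed", folded Pow_UNIV] that
  proof (induction A rule: sigma_sets_induct_disjoint)
    case (basic A)
    then show ?case
      by (simp add: closed)
  next
    case (compl A)
    then have A: "A \<in> sets borel"
      by (simp add: borel_eq_closed)
    have "(\<integral>x. h x * indicator (UNIV - A) x \<partial>?\<mu>) = (\<integral>x. h x * indicator UNIV x - h x * indicator A x \<partial>?\<mu>)"
      by (intro Bochner_Integration.integral_cong) (auto split: split_indicator)
    also have "\<dots> = (\<integral>x. h x * indicator UNIV x \<partial>?\<mu>) - (\<integral>x. h x * indicator A x \<partial>?\<mu>)"
      by (intro Bochner_Integration.integral_diff int A) auto
    finally show ?case
      using closed[of UNIV] compl.IH by simp
  next
    case (union A)
    have A: "A i \<in> sets borel" for i
      using union.hyps(2) by (auto simp: borel_eq_closed)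
    have "(\<lambda>n. \<integral>x. h x * (\<Sum>i<n. indicator (A i) x) \<partial>?\<mu>) \<longlonglongrightarrow> (\<integral>x. h x * indicator (\<Union>i. A i) x \<partial>?\<mu>)"
    proof (rule integral_dominated_convergence[where w = "\<lambda>x. \<bar>h x\<bar>"])
      note [measurable] = ind[OF A]
      show "(\<lambda>x. h x * indicator (\<Union>i. A i) x) \<in> borel_measurable ?\<mu>"
        using A int[of "\<Union>i. A i"] by auto
      show "(\<lambda>x. h x * (\<Sum>i<n. indicator (A i) x)) \<in> borel_measurable ?\<mu>" for n
        by measurable
      show "AE x in ?\<mu>. (\<lambda>n. h x * (\<Sum>i<n. indicator (A i) x)) \<longlonglongrightarrow> h x * indicator (\<Union>i. A i) x"
        using indicator_sums[of A] union.hyps(1)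
        by (intro AE_I2 tendsto_mult_left) (auto simp: sums_def disjoint_family_on_def)
      show "AE x in ?\<mu>. norm (h x * (\<Sum>i<n. indicator (A i) x)) \<le> \<bar>h x\<bar>" for n
      proof (rule AE_I2)
        fix x
        have "(\<Sum>i<n. indicator (A i) x :: real) = indicator (\<Union>i<n. A i) x"
          using union.hyps(1) by (intro indicator_UN_disjoint[symmetric]) (auto simp: disjoint_family_on_def)
        then show "norm (h x * (\<Sum>i<n. indicator (A i) x)) \<le> \<bar>h x\<bar>"
          by (simp add: abs_mult split: split_indicator)
      qed
    qed (use h in auto)
    moreover have "(\<integral>x. h x * (\<Sum>i<n. indicator (A i) x) \<partial>?\<mu>) = 0" for n
      unfolding sum_distrib_left using union.IH
      by (subst Bochner_Integration.integral_sum) (simp_all add: int A)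
    ultimately show ?case
      by (simp add: LIMSEQ_const_iff)
  qed simp
  note borel = this
  show "set_lebesgue_integral ?\<mu> A h = 0" if "A \<in> sets ?\<mu>" for A
  proof -
    have "A \<in> sets borel"
      using that by (simp add: sets_gasket_measure sets_restrict_SG)
    then have "A \<in> sigma_sets UNIV (Collect closed)"
      by (simp add: borel_eq_closed)
    then show ?thesis
      using borel[of A] by (simp add: set_lebesgue_integral_def mult.commute)
  qed
qed

lemma square_integrable_imp_integrable:
  assumes "f \<in> borel_measurable (gasket_measure q)" "integrable (gasket_measure q) (\<lambda>x. (f x)\<^sup>2)"
  shows "integrable (gasket_measure q) (f :: real^2 \<Rightarrow> real)"
proof (rule Bochner_Integration.integrable_bound)
  show "integrable (gasket_measure q) (\<lambda>x. 1 + (f x)\<^sup>2)"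
    using assms by simp
  have "\<bar>t\<bar> \<le> 1 + t\<^sup>2" for t :: real
    using zero_le_power2[of "\<bar>t\<bar> - 1"] zero_le_power2[of t] by (simp add: power2_diff)
  then show "AE x in gasket_measure q. norm (f x) \<le> norm (1 + (f x)\<^sup>2)"
    by (intro AE_I2) (simp add: abs_of_nonneg)
qed (use assms in auto)

lemma square_integrable_mult:
  assumes "f \<in> borel_measurable (gasket_measure q)" "integrable (gasket_measure q) (\<lambda>x. (f x)\<^sup>2)"
    and "g \<in> borel_measurable (gasket_measure q)" "integrable (gasket_measure q) (\<lambda>x. (g x)\<^sup>2)"
  shows "integrable (gasket_measure q) (\<lambda>x. f x * g x :: real)"
proof (rule Bochner_Integration.integrable_bound)
  show "integrable (gasket_measure q) (\<lambda>x. (f x)\<^sup>2 + (g x)\<^sup>2)"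
    using assms by simp
  have "\<bar>s * t\<bar> \<le> s\<^sup>2 + t\<^sup>2" for s t :: real
    using sum_squares_bound[of "\<bar>s\<bar>" "\<bar>t\<bar>"] abs_ge_zero[of "s * t"]
    by (simp only: power2_abs abs_mult)
  then show "AE x in gasket_measure q. norm (f x * g x) \<le> norm ((f x)\<^sup>2 + (g x)\<^sup>2)"
    by (intro AE_I2) (simp add: abs_of_nonneg)
qed (use assms in auto)

text \<open>The objective is stated with the arbitrary representative \<open>laplacian q v\<close>;
  this allows its value to be computed from any other one.\<close>

lemma has_laplacian_AE_unique:
  assumes "has_laplacian q u f" "has_laplacian q u g"
  shows "AE x in gasket_measure q. f x = g x"
proof -
  have f: "f \<in> borel_measurable (gasket_measure q)" "integrable (gasket_measure q) (\<lambda>x. (f x)\<^sup>2)"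
    and g: "g \<in> borel_measurable (gasket_measure q)" "integrable (gasket_measure q) (\<lambda>x. (g x)\<^sup>2)"
    using assms by (auto simp: has_laplacian_def)
  have int: "integrable (gasket_measure q) f" "integrable (gasket_measure q) g"
    using f g by (auto intro: square_integrable_imp_integrable)
  have "AE x in gasket_measure q. f x - g x = 0"
  proof (rule orthogonal_AE_0)
    fix v assume v: "v \<in> dom_energy q" "\<forall>x\<in>V q 0. v x = 0"
    have "v \<in> borel_measurable (gasket_measure q)" "integrable (gasket_measure q) (\<lambda>x. (v x)\<^sup>2)"
      using dom_energy_continuous[OF v(1)] 
      by (auto intro!: continuous_measurable sets_gasket_measure continuous_integrable gasket_measure continuous_intros)
    then have "(\<integral>x. (f x - g x) * v x \<partial>gasket_measure q) =
        (\<integral>x. f x * v x \<partial>gasket_measure q) - (\<integral>x. g x * v x \<partial>gasket_measure q)"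
      unfolding left_diff_distrib
      by (intro Bochner_Integration.integral_diff square_integrable_mult f g)
    moreover have "energy_form q u v = - (\<integral>x. f x * v x \<partial>gasket_measure q)"
      "energy_form q u v = - (\<integral>x. g x * v x \<partial>gasket_measure q)"
      using assms v unfolding has_laplacian_def by blast+
    ultimately show "(\<integral>x. (f x - g x) * v x \<partial>gasket_measure q) = 0"
      by simp
  qed (use int in auto)
  then show ?thesis
    by eventually_elim simp
qed

section \<open>Comparison of the minimizer with the spline\<close>

lemma has_laplacian_laplacian: "u \<in> dom_laplacian q \<Longrightarrow> has_laplacian q u (laplacian q u)"
  using someI_ex[of "has_laplacian q u"] by (simp add: dom_laplacian_def laplacian_def)

lemma cell_form_commute: "cell_form a b = cell_form b a"
  by (simp add: cell_form_def mult.commute)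

lemma graph_form_commute: "graph_form n u v = graph_form n v u"
  unfolding graph_form_def by (simp add: cell_form_commute)

text \<open>Without a source the Gauss-Green formula consists of the flux term alone, which sees the
  other function only at the vertices of level \<open>m\<close>.\<close>

lemma energy_form_harmonic_spline_cong:
  assumes "u \<in> dom_energy q" "v \<in> dom_energy q" "\<And>x. x \<in> V q m \<Longrightarrow> u x = v x"
  shows "energy_form q u (spline m p (\<lambda>_. 0)) = energy_form q v (spline m p (\<lambda>_. 0))"
proof -
  let ?P = "spline m p (\<lambda>_. 0)"
  \<comment> \<open>This is the source term of \<open>?P\<close>: the Laplacian data of a piecewise
    harmonic function are the spline with zero data.\<close>
  have Z: "spline m (\<lambda>_. 0) (\<lambda>_. 0) (corner q w i) = 0" for w i
  proof -
    have "(\<lambda>i. fst (spline_state m (\<lambda>_. 0) (\<lambda>_. 0) w) i / 5 ^ length w) = (\<lambda>_. 0)"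
      using snd_spline_state[of m p "\<lambda>_. 0" w] snd_spline_state_0[of m p w] by simp
    then have "fst (spline_state m (\<lambda>_. 0) (\<lambda>_. 0) w) i = 0"
      by (simp add: fun_eq_iff)
    then show ?thesis
      using fun_cong[OF corner_vals_spline[of m "\<lambda>_. 0" "\<lambda>_. 0" w], of i] by (simp add: corner_vals_def)
  qed
  have "flux_form m s u = flux_form m s v" for s
    unfolding flux_form_def
    by (intro arg_cong2[of _ _ _ _ "(*)"] refl sum.cong) (use assms(3) corner_in_V in \<open>auto simp: words_def\<close>)
  then have "graph_form n u ?P = graph_form n v ?P" if "n \<ge> m" for n
    unfolding graph_form_commute[of n _ ?P] graph_form_spline[OF that] by (simp add: Z)
  then have "(\<lambda>n. graph_form n u ?P) \<longlonglongrightarrow> energy_form q v ?P"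
    by (intro Lim_transform_eventually[OF energy_form_tendsto[OF assms(2) spline_in_dom_energy]])
       (auto simp: eventually_sequentially intro!: exI[of _ m])
  with energy_form_tendsto[OF assms(1) spline_in_dom_energy] show ?thesis
    by (rule LIMSEQ_unique)
qed

text \<open>The spline \<open>U\<close> interpolates \<open>u\<close> at all vertices of level \<open>m\<close>, and its Laplacian \<open>P\<close> is
  harmonic on the cells of level \<open>m\<close>. Hence \<open>\<Delta>u - P\<close> is orthogonal to \<open>P\<close>, and minimality of
  \<open>u\<close> forces \<open>\<Delta>u = P\<close>.\<close>

lemma minimizer_laplacian:
  assumes E: "E \<subseteq> V q m"
    and min: "is_arg_min (\<lambda>v. \<integral>y. \<bar>laplacian q v y\<bar>\<^sup>2 \<partial>gasket_measure q)
      (\<lambda>v. v \<in> dom_laplacian q \<and> (\<forall>x\<in>E. v x = a x)) u"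
  obtains P where "has_laplacian q u P" "continuous_on (SG q) P"
    "\<And>z. z \<in> V q m - V q 0 \<Longrightarrow> discrete_laplacian q m u z =
       (14 * P z + 4 * (\<Sum>y | adjacent q m y z. P y)) / (45 * 5 ^ m)"
proof -
  let ?\<mu> = "gasket_measure q"
  define f where "f = laplacian q u"
  have "u \<in> dom_laplacian q"
    using min by (simp add: is_arg_min_def)
  then have lap_u: "has_laplacian q u f"
    unfolding f_def by (rule has_laplacian_laplacian)
  obtain p where p0: "\<forall>z\<in>V q 0. p z = 0"
    and p: "\<forall>z\<in>V q m - V q 0. 14 * p z + 4 * (\<Sum>y | adjacent q m y z. p y) =
      45 * 5 ^ m * discrete_laplacian q m u z"
    using discrete_equation_solvable[of m "\<lambda>z. 45 * 5 ^ m * discrete_laplacian q m u z"] by (elim exE conjE)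
  define P where "P = spline m p (\<lambda>_. 0)"
  define U where "U = spline m u p"
  have lap_U: "has_laplacian q U P"
    unfolding U_def P_def by (rule has_laplacian_spline) (use p in simp)
  have dom: "u \<in> dom_energy q" "U \<in> dom_energy q" "P \<in> dom_energy q"
    using lap_u spline_in_dom_energy by (auto simp: has_laplacian_def U_def P_def)
  have Uu: "U x = u x" if "x \<in> V q m" for x
    unfolding U_def using that by (rule spline_on_V)
  \<comment> \<open>This admits \<open>P\<close> as a test function in the weak equations of both
    \<open>u\<close> and \<open>U\<close>.\<close>
  have P0: "\<forall>x\<in>V q 0. P x = 0"
  proof
    fix x assume x: "x \<in> V q 0"
    then have "x \<in> V q m"
      by (rule subsetD[OF V_mono[OF le0]])
    then have "P x = p x"
      unfolding P_def by (rule spline_on_V)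
    then show "P x = 0"
      using bspec[OF p0 x] by simp
  qed
  have f: "f \<in> borel_measurable ?\<mu>" "integrable ?\<mu> (\<lambda>x. (f x)\<^sup>2)"
    and P: "P \<in> borel_measurable ?\<mu>" "integrable ?\<mu> (\<lambda>x. (P x)\<^sup>2)"
    using lap_u lap_U by (auto simp: has_laplacian_def)
  have "energy_form q u P = energy_form q U P"
    unfolding P_def by (rule energy_form_harmonic_spline_cong[OF dom(1,2)]) (simp add: Uu)
  \<comment> \<open>The weak equations tested with \<open>P\<close> identify the two energies as
    minus the integral of \<open>f x * P x\<close> and minus that of
    \<open>(P x)\<^sup>2\<close>.\<close>
  then have fP: "(\<integral>x. f x * P x \<partial>?\<mu>) = (\<integral>x. (P x)\<^sup>2 \<partial>?\<mu>)"
    using lap_u lap_U dom(3) P0 unfolding has_laplacian_def by (simp add: power2_eq_square)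
  have U_dom: "U \<in> dom_laplacian q"
    using lap_U by (auto simp: dom_laplacian_def)
  have "\<forall>x\<in>E. U x = a x"
    using min Uu E by (auto simp: is_arg_min_def)
  with U_dom have "(\<integral>x. (f x)\<^sup>2 \<partial>?\<mu>) \<le> (\<integral>x. (laplacian q U x)\<^sup>2 \<partial>?\<mu>)"
    using min by (auto simp: is_arg_min_def f_def not_less)
  also have "\<dots> = (\<integral>x. (P x)\<^sup>2 \<partial>?\<mu>)"
  proof (rule integral_cong_AE)
    have lap: "has_laplacian q U (laplacian q U)"
      using U_dom by (rule has_laplacian_laplacian)
    then show "(\<lambda>x. (laplacian q U x)\<^sup>2) \<in> borel_measurable ?\<mu>"
      unfolding has_laplacian_def by (elim conjE) (rule borel_measurable_integrable)
    show "AE x in ?\<mu>. (laplacian q U x)\<^sup>2 = (P x)\<^sup>2"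
      using has_laplacian_AE_unique[OF lap lap_U] by eventually_elim simp
  qed (use P in simp)
  finally have le: "(\<integral>x. (f x)\<^sup>2 \<partial>?\<mu>) \<le> (\<integral>x. (P x)\<^sup>2 \<partial>?\<mu>)" .
  have int_fP: "integrable ?\<mu> (\<lambda>x. f x * P x)"
    by (rule square_integrable_mult[OF f P])
  have expand: "(f x - P x)\<^sup>2 = (f x)\<^sup>2 - 2 * (f x * P x) + (P x)\<^sup>2" for x
    by (simp add: power2_diff)
  have int: "integrable ?\<mu> (\<lambda>x. (f x - P x)\<^sup>2)"
    unfolding expand using f(2) P(2) int_fP by simp
  \<comment> \<open>By \<open>fP\<close> the right side equals the integral of
    \<open>(f x)\<^sup>2\<close> minus that of \<open>(P x)\<^sup>2\<close>, which minimality makes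
    nonpositive.\<close>
  have "(\<integral>x. (f x - P x)\<^sup>2 \<partial>?\<mu>) = (\<integral>x. (f x)\<^sup>2 \<partial>?\<mu>) - 2 * (\<integral>x. f x * P x \<partial>?\<mu>) + (\<integral>x. (P x)\<^sup>2 \<partial>?\<mu>)"
    unfolding expand using f(2) P(2) int_fP by simp
  then have "(\<integral>x. (f x - P x)\<^sup>2 \<partial>?\<mu>) \<le> 0"
    using le fP by simp
  moreover have "0 \<le> (\<integral>x. (f x - P x)\<^sup>2 \<partial>?\<mu>)"
    by simp
  ultimately have "(\<integral>x. (f x - P x)\<^sup>2 \<partial>?\<mu>) = 0"
    by (rule antisym)
  then have "AE x in ?\<mu>. (f x - P x)\<^sup>2 = 0"
    using integral_nonneg_eq_0_iff_AE[OF int] by simp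
  then have fP_AE: "AE x in ?\<mu>. f x = P x"
    by eventually_elim simp
  have cont: "continuous_on (SG q) P"
    unfolding P_def by (rule continuous_spline)
  have "has_laplacian q u P"
    unfolding has_laplacian_def
  proof (intro conjI ballI impI dom P)
    fix v assume v: "v \<in> dom_energy q" "\<forall>x\<in>V q 0. v x = 0"
    have [measurable]: "v \<in> borel_measurable ?\<mu>" "f \<in> borel_measurable ?\<mu>" "P \<in> borel_measurable ?\<mu>"
      using continuous_measurable[OF sets_gasket_measure dom_energy_continuous[OF v(1)]] f P by auto
    have "(\<integral>x. f x * v x \<partial>?\<mu>) = (\<integral>x. P x * v x \<partial>?\<mu>)"
      using fP_AE by (intro integral_cong_AE) auto
    then show "energy_form q u v = - (\<integral>x. P x * v x \<partial>?\<mu>)"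
      using lap_u v by (simp add: has_laplacian_def)
  qed
  moreover have "discrete_laplacian q m u z = (14 * P z + 4 * (\<Sum>y | adjacent q m y z. P y)) / (45 * 5 ^ m)"
    if z: "z \<in> V q m - V q 0" for z
  proof -
    have "P y = p y" if "adjacent q m y z" for y
      unfolding P_def using that by (intro spline_on_V) (auto simp: adjacent_iff V_eq_corner)
    then have "(\<Sum>y | adjacent q m y z. P y) = (\<Sum>y | adjacent q m y z. p y)"
      by (intro sum.cong) auto
    moreover have "P z = p z"
      unfolding P_def using z by (intro spline_on_V) blast
    ultimately show ?thesis
      using bspec[OF p z] by simp
  qed
  ultimately show ?thesis
    using cont by (intro that)
qed

end

theorem lemma3p10:
  fixes q :: "3 \<Rightarrow> real^2"
    and m n :: nat
    and x :: "nat \<Rightarrow> real^2"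
    and a :: "nat \<Rightarrow> real"
    and u :: "real^2 \<Rightarrow> real"
  assumes "equilateral q"
    and "3 \<le> n"
    and "inj_on x {1..n}"
    and "x ` {1..n} \<subseteq> V q m"
    and "invertible
           (vector [vector [harmonic_basis q 0 (x 1), harmonic_basis q 1 (x 1), harmonic_basis q 2 (x 1)],
                    vector [harmonic_basis q 0 (x 2), harmonic_basis q 1 (x 2), harmonic_basis q 2 (x 2)],
                    vector [harmonic_basis q 0 (x 3), harmonic_basis q 1 (x 3), harmonic_basis q 2 (x 3)]]
              :: real^3^3)"
    and "is_arg_min (\<lambda>v. \<integral>y. \<bar>laplacian q v y\<bar>\<^sup>2 \<partial>gasket_measure q)
           (\<lambda>v. v \<in> dom_laplacian q \<and> (\<forall>i\<in>{1..n}. v (x i) = a i)) u"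
  shows "\<exists>f. has_laplacian q u f \<and> continuous_on (SG q) f \<and>
           (\<forall>z \<in> V q m - V q 0.
              discrete_laplacian q m u z =
                1 / (45 * 5 ^ m) * (14 * f z + 4 * (\<Sum>y | adjacent q m y z. f y)))"

proof -
  interpret gasket q
    using assms(1) by (rule gasket.intro)
  let ?E = "x ` {1..n}"
  \<comment> \<open>The points are distinct, so the prescribed values, indexed by \<open>i\<close>,
    become a function of the point itself.\<close>
  define b where "b = a \<circ> the_inv_into {1..n} x"
  have "b (x i) = a i" if "i \<in> {1..n}" for i
    using the_inv_into_f_f[OF assms(3) that] by (simp add: b_def)
  then have "(\<lambda>v. v \<in> dom_laplacian q \<and> (\<forall>y\<in>?E. v y = b y)) =
      (\<lambda>v. v \<in> dom_laplacian q \<and> (\<forall>i\<in>{1..n}. v (x i) = a i))"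
    by (auto simp: fun_eq_iff)
  with assms(6) have "is_arg_min (\<lambda>v. \<integral>y. \<bar>laplacian q v y\<bar>\<^sup>2 \<partial>gasket_measure q)
      (\<lambda>v. v \<in> dom_laplacian q \<and> (\<forall>y\<in>?E. v y = b y)) u"
    by simp
  from minimizer_laplacian[OF assms(4) this]
  obtain P where "has_laplacian q u P" "continuous_on (SG q) P"
    "\<And>z. z \<in> V q m - V q 0 \<Longrightarrow> discrete_laplacian q m u z =
       (14 * P z + 4 * (\<Sum>y | adjacent q m y z. P y)) / (45 * 5 ^ m)"
    by metis
  then show ?thesis
    by (intro exI[of _ P]) simp
qed

end
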